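(* Assume Hypothesis (H): there is a constant $d \geq 1$ such that every language in $\mathsf{P}$ is decided by Boolean circuits of size $O(n^d)$. Fix $0<\epsilon<1$, and for $k\ge 1$ let $s=s(k)=2^{\epsilon k}$, $m=2^k$ and $n=n(m)=10 s\log s$. Then there is no constant $t\ge 1$ and no polynomial-time algorithm $S$ (the Student) such that for every $k$ (with $n<m$) and all $x_1,\dots,x_t\in\{0,1\}^n$ the outputs $S(1^{(m)}),S(1^{(m)},x_1),\dots,S(1^{(m)},x_1,\dots,x_{t-1})$ lie in $\{0,1\}^m$ and $$\mathrm{tt}_{s,k}(x_1)\neq S(1^{(m)})\ \vee\ \mathrm{tt}_{s,k}(x_2)\neq S(1^{(m)},x_1)\ \vee\dots\vee\ \mathrm{tt}_{s,k}(x_t)\neq S(1^{(m)},x_1,\dots,x_{t-1}).$$ That is, the dual weak pigeonhole principle for $\mathrm{tt}_{s,k}$ cannot be witnessed by a Student–Teacher computation with a polynomial-time Student and constantly many rounds.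
   Context: The truth-table function $\mathrm{tt}_{s,k}$ maps (a code of) a Boolean circuit of size $s$ with $k$ inputs, encoded in the natural way by a string of $n=10s\log s$ bits, to its truth table, a string of length $m=2^k$; it is assumed that $n<m$. The dual weak pigeonhole principle for it states: for every $m=2^k>1$ there is $y\in\{0,1\}^m$ such that $\mathrm{tt}_{s,k}(x)\neq y$ for all $x\in\{0,1\}^n$. A Student–Teacher computation with $t$ rounds: on input $1^{(m)}$ the Student proposes $b_1$; a computationally unbounded Teacher either accepts (if $b_1\notin$ range) or gives $x_1$ with $\mathrm{tt}_{s,k}(x_1)=b_1$; the Student then proposes $b_2$ computed from $1^{(m)},x_1$, and so on; success within $t$ rounds for every Teacher is exactly the displayed universal disjunction. Here $1^{(m)}$ denotes the string of $m$ ones. *)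

theory Defs
  imports
    "HOL-Library.Landau_Symbols"
    "HOL-Computational_Algebra.Polynomial"
begin

section \<open>Polynomial time: deterministic multi-tape Turing machines\<close>

text \<open>
  Tape symbols are natural numbers: 0 is the blank, 1 and 2 are the bits, 3 is the separator
  used for tuples, and larger numbers are further work symbols. The working states are
  the numbers below \<open>states M\<close>, the initial state is 0, and \<open>states M\<close> itself is the
  halting state. A two-way infinite tape is stored relative to its head, which
  scans cell 0, so that a head movement is a shift of the tape.
\<close>

datatype direction = Leftwards | Stay | Rightwards

type_synonym tape = "int \<Rightarrow> nat"

type_synonym config = "nat \<times> tape list"

record tm =
  tapes :: nat
  states :: nat
  symbols :: nat
  delta :: "nat \<Rightarrow> nat list \<Rightarrow> nat \<times> (nat \<times> direction) list"

definition wf_tm :: "tm \<Rightarrow> bool" where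
  "wf_tm M \<longleftrightarrow> 1 \<le> tapes M \<and> 1 \<le> states M \<and> 4 \<le> symbols M \<and>
     (\<forall>q v. q < states M \<and> length v = tapes M \<and> set v \<subseteq> {..<symbols M} \<longrightarrow>
        (case delta M q v of (q', acts) \<Rightarrow>
           q' \<le> states M \<and> length acts = tapes M \<and> fst ` set acts \<subseteq> {..<symbols M}))"

fun offset :: "direction \<Rightarrow> int" where
  "offset Leftwards = - 1"
| "offset Stay = 0"
| "offset Rightwards = 1"

definition act_on :: "nat \<times> direction \<Rightarrow> tape \<Rightarrow> tape" where
  "act_on a f = (\<lambda>i. (f(0 := fst a)) (i + offset (snd a)))"

definition tm_step :: "tm \<Rightarrow> config \<Rightarrow> config" where
  "tm_step M c =
     (case c of (q, ts) \<Rightarrow>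
        if q < states M
        then (case delta M q (map (\<lambda>f. f 0) ts) of (q', acts) \<Rightarrow> (q', map2 act_on acts ts))
        else c)"

definition blank_tape :: tape where
  "blank_tape = (\<lambda>i. 0)"

definition tape_of :: "nat list \<Rightarrow> tape" where
  "tape_of w = (\<lambda>i. if 0 \<le> i \<and> i < int (length w) then w ! nat i else 0)"

definition init_config :: "tm \<Rightarrow> nat list \<Rightarrow> config" where
  "init_config M w = (0, tape_of w # replicate (tapes M - 1) blank_tape)"

text \<open>The output is the word on the first tape that starts at the head and is ended by a blank.\<close>

definition tape_shows :: "tape \<Rightarrow> nat list \<Rightarrow> bool" where
  "tape_shows f w \<longleftrightarrow> (\<forall>i < length w. f (int i) = w ! i) \<and> f (int (length w)) = 0"

definition halts_with :: "tm \<Rightarrow> nat list \<Rightarrow> nat list \<Rightarrow> nat \<Rightarrow> bool" where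
  "halts_with M w out T \<longleftrightarrow>
     (\<exists>r \<le> T. case (tm_step M ^^ r) (init_config M w) of (q, ts) \<Rightarrow>
        q = states M \<and> tape_shows (hd ts) out)"

definition bits_word :: "bool list \<Rightarrow> nat list" where
  "bits_word x = map (\<lambda>b. if b then 2 else 1) x"

definition tuple_word :: "bool list list \<Rightarrow> nat list" where
  "tuple_word xs = concat (map (\<lambda>x. bits_word x @ [3]) xs)"

text \<open>Polynomial-time computability of a string function of a tuple (of any length) of strings.\<close>

definition polytime_computable :: "(bool list list \<Rightarrow> bool list) \<Rightarrow> bool" where
  "polytime_computable F \<longleftrightarrow>
     (\<exists>M (p :: nat poly). wf_tm M \<and>
        (\<forall>xs. halts_with M (tuple_word xs) (bits_word (F xs)) (poly p (length (tuple_word xs)))))"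

definition class_P :: "bool list set set" where
  "class_P = {L. \<exists>M (p :: nat poly). wf_tm M \<and>
     (\<forall>x. halts_with M (bits_word x) (bits_word [x \<in> L]) (poly p (length x)))}"


section \<open>Boolean circuits\<close>

text \<open>
  A circuit is a straight-line program: the arguments of a gate are positions of earlier
  gates, and the last gate is the output. Its size is the number of its gates, input and constant
  gates included.
\<close>

datatype gate = Inp nat | Const bool | Neg nat | And nat nat | Or nat nat

type_synonym circuit = "gate list"

fun wf_gate :: "nat \<Rightarrow> nat \<Rightarrow> gate \<Rightarrow> bool" where
  "wf_gate k p (Inp i) \<longleftrightarrow> i < k"
| "wf_gate k p (Const b) \<longleftrightarrow> True"
| "wf_gate k p (Neg i) \<longleftrightarrow> i < p"
| "wf_gate k p (And i j) \<longleftrightarrow> i < p \<and> j < p"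
| "wf_gate k p (Or i j) \<longleftrightarrow> i < p \<and> j < p"

definition wf_circuit :: "nat \<Rightarrow> circuit \<Rightarrow> bool" where
  "wf_circuit k C \<longleftrightarrow> C \<noteq> [] \<and> (\<forall>p < length C. wf_gate k p (C ! p))"

fun gate_val :: "bool list \<Rightarrow> bool list \<Rightarrow> gate \<Rightarrow> bool" where
  "gate_val x v (Inp i) = x ! i"
| "gate_val x v (Const b) = b"
| "gate_val x v (Neg i) = (\<not> v ! i)"
| "gate_val x v (And i j) = (v ! i \<and> v ! j)"
| "gate_val x v (Or i j) = (v ! i \<or> v ! j)"

definition circuit_eval :: "circuit \<Rightarrow> bool list \<Rightarrow> bool" where
  "circuit_eval C x = last (foldl (\<lambda>v g. v @ [gate_val x v g]) [] C)"

definition decided_by :: "bool list set \<Rightarrow> (nat \<Rightarrow> circuit) \<Rightarrow> bool" where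
  "decided_by L C \<longleftrightarrow>
     (\<forall>n. wf_circuit n (C n)) \<and> (\<forall>x. x \<in> L \<longleftrightarrow> circuit_eval (C (length x)) x)"

definition hypothesis_H :: bool where
  "hypothesis_H \<longleftrightarrow>
     (\<exists>d :: nat. 1 \<le> d \<and>
        (\<forall>L \<in> class_P. \<exists>C. decided_by L C \<and> (\<lambda>n. real (length (C n))) \<in> O(\<lambda>n. real n ^ d)))"


section \<open>The truth-table function\<close>

definition size_bound :: "real \<Rightarrow> nat \<Rightarrow> nat" where
  "size_bound \<epsilon> k = nat \<lceil>2 powr (\<epsilon> * real k)\<rceil>"

definition code_len :: "nat \<Rightarrow> nat" where
  "code_len s = nat \<lceil>10 * real s * log 2 (real s)\<rceil>"

text \<open>
  A gate is coded by a three-bit operation code and two address fields, unused fields being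
  zero. As no operation code consists of three zeros, a code can be padded with zeros.
\<close>

definition addr_width :: "nat \<Rightarrow> nat \<Rightarrow> nat" where
  "addr_width s k = nat \<lceil>log 2 (real (max s k))\<rceil>"

definition nat_bits :: "nat \<Rightarrow> nat \<Rightarrow> bool list" where
  "nat_bits w i = map (bit i) [0..<w]"

fun gate_code :: "nat \<Rightarrow> gate \<Rightarrow> bool list" where
  "gate_code w (Inp i) = [False, False, True] @ nat_bits w i @ nat_bits w 0"
| "gate_code w (Const b) = [False, True, b] @ nat_bits w 0 @ nat_bits w 0"
| "gate_code w (Neg i) = [True, False, False] @ nat_bits w i @ nat_bits w 0"
| "gate_code w (And i j) = [True, False, True] @ nat_bits w i @ nat_bits w j"
| "gate_code w (Or i j) = [True, True, False] @ nat_bits w i @ nat_bits w j"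

definition gates_code :: "nat \<Rightarrow> circuit \<Rightarrow> bool list" where
  "gates_code w C = concat (map (gate_code w) C)"

definition circuit_code :: "nat \<Rightarrow> nat \<Rightarrow> circuit \<Rightarrow> bool list" where
  "circuit_code s k C =
     (let g = gates_code (addr_width s k) C in g @ replicate (code_len s - length g) False)"

definition codes :: "nat \<Rightarrow> nat \<Rightarrow> bool list \<Rightarrow> circuit \<Rightarrow> bool" where
  "codes s k x C \<longleftrightarrow> wf_circuit k C \<and> length C \<le> s \<and> x = circuit_code s k C"

definition truth_table :: "nat \<Rightarrow> circuit \<Rightarrow> bool list" where
  "truth_table k C = map (\<lambda>j. circuit_eval C (nat_bits k j)) [0..<2 ^ k]"

text \<open>Strings that are not codes are mapped to the zero string.\<close>

definition tt :: "nat \<Rightarrow> nat \<Rightarrow> bool list \<Rightarrow> bool list" where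
  "tt s k x =
     (if \<exists>C. codes s k x C then truth_table k (THE C. codes s k x C)
      else replicate (2 ^ k) False)"


subsection \<open>Adequacy of the encoding\<close>

lemma length_gate_code: "length (gate_code w g) = 3 + 2 * w"
  by (cases g) (simp_all add: nat_bits_def)

lemma length_gates_code: "length (gates_code w C) = length C * (3 + 2 * w)"
  by (induction C) (simp_all add: gates_code_def length_gate_code)

lemma length_circuit_code:
  assumes "2 \<le> s" "k \<le> s" "length C \<le> s"
  shows "length (circuit_code s k C) = code_len s"
proof -
  define l where "l = log 2 (real s)"
  have l: "1 \<le> l" using assms(1) by (simp add: l_def le_log_iff)
  have w: "real (addr_width s k) \<le> l + 1"
    using assms(2) l unfolding addr_width_def l_def by (simp add: max_absorb1)
  have "real (length C * (3 + 2 * addr_width s k)) = real (length C) * (3 + 2 * real (addr_width s k))"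
    by simp
  also have "\<dots> \<le> real s * (10 * l)"
    using assms(3) w l by (intro mult_mono) auto
  finally have "real (length C * (3 + 2 * addr_width s k)) \<le> 10 * real s * l"
    by (simp add: algebra_simps)
  then have "length C * (3 + 2 * addr_width s k) \<le> code_len s"
    unfolding code_len_def l_def by linarith
  then show ?thesis
    by (simp add: circuit_code_def Let_def length_gates_code)
qed

lemma nat_bits_inj:
  assumes "nat_bits w i = nat_bits w j" "i < 2 ^ w" "j < 2 ^ w"
  shows "i = j"
proof -
  have "bit i r = bit j r" if "r < w" for r
    using assms(1) that by (simp add: nat_bits_def)
  then have "take_bit w i = take_bit w j"
    by (auto simp: bit_eq_iff bit_take_bit_iff)
  then show ?thesis
    using assms(2,3) by (simp add: take_bit_nat_eq_self)
qed

lemma nat_bits_length [simp]: "length (nat_bits w i) = w"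
  by (simp add: nat_bits_def)

lemma gate_code_inj:
  assumes "gate_code w g = gate_code w h" "wf_gate k p g" "wf_gate k p h" "k \<le> 2 ^ w" "p \<le> 2 ^ w"
  shows "g = h"
  using assms by (cases g; cases h) (auto dest!: nat_bits_inj)

lemma gate_code_not_zeros: "gate_code w g @ xs \<noteq> replicate r False"
proof
  assume "gate_code w g @ xs = replicate r False"
  then have "set (take 3 (gate_code w g)) \<subseteq> {False}"
    by (metis set_replicate_conv_if append_take_drop_id append_assoc set_append Un_subset_iff order_refl subset_insertI2 empty_subsetI)
  then show False
    by (cases g) (auto simp: numeral_3_eq_3)
qed

lemma gates_code_inj:
  assumes "gates_code w C @ replicate a False = gates_code w D @ replicate b False"
    and "\<forall>p < length C. wf_gate k (q + p) (C ! p)" "\<forall>p < length D. wf_gate k (q + p) (D ! p)"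
    and "k \<le> 2 ^ w" "q + length C \<le> 2 ^ w" "q + length D \<le> 2 ^ w"
  shows "C = D"
  using assms
proof (induction C arbitrary: D q)
  case Nil
  then show ?case
    by (cases D) (use gate_code_not_zeros in \<open>auto simp: gates_code_def dest: sym\<close>)
next
  case (Cons g C)
  show ?case
  proof (cases D)
    case Nil
    then show ?thesis
      using Cons.prems(1) gate_code_not_zeros by (auto simp: gates_code_def)
  next
    case D: (Cons h D')
    have eq: "gate_code w g = gate_code w h"
      "gates_code w C @ replicate a False = gates_code w D' @ replicate b False"
      using Cons.prems(1) D by (auto simp: gates_code_def length_gate_code)
    have "g = h"
      using eq(1) Cons.prems(2-) D by (intro gate_code_inj[of w g h k q]) auto
    moreover have "C = D'"
      using eq(2) Cons.prems(2-) D by (intro Cons.IH[of D' "Suc q"]) auto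
    ultimately show ?thesis using D by simp
  qed
qed

lemma codes_unique:
  assumes "codes s k x C" "codes s k x D"
  shows "C = D"
proof -
  have "C \<noteq> []" "length C \<le> s"
    using assms(1) by (auto simp: codes_def wf_circuit_def)
  then have "1 \<le> s" by (cases C) auto
  then have "log 2 (real (max s k)) \<le> real (addr_width s k)"
    by (simp add: addr_width_def)
  then have "real (max s k) \<le> 2 powr real (addr_width s k)"
    using \<open>1 \<le> s\<close> by (subst (asm) log_le_iff) auto
  then have "real (max s k) \<le> real (2 ^ addr_width s k)"
    by (simp add: powr_realpow)
  then have "max s k \<le> 2 ^ addr_width s k"
    by (simp only: of_nat_le_iff)
  then show ?thesis
    using assms
    by (intro gates_code_inj[of "addr_width s k" C _ D _ k 0])
      (auto simp: codes_def circuit_code_def Let_def wf_circuit_def)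
qed

end

theory Submission
  imports Defs "HOL-Real_Asymp.Real_Asymp"
begin

text \<open>
  The Teacher answers every proposal of the Student by a very small circuit. Let \<open>B\<close> be a power of
  two of size about \<open>2\<close> to the power \<open>\<delta> * k\<close> with a tiny constant \<open>\<delta>\<close>. The Student's input in
  round \<open>i\<close>, together with an index \<open>j\<close>, can be described by a string of length polynomial in \<open>B\<close>: earlier
  answers are codes of small circuits padded with zeros, and runs of equal bits compress to numbers in base
  \<open>B\<close>. Expanding such a description has polynomial cost because \<open>2 ^ k\<close> is polynomial in \<open>B\<close>, so the
  language of those descriptions for which bit \<open>j\<close> of the Student's proposal is 1 lies in P. Under the
  hypothesis it has circuits of size polynomial in \<open>B\<close>, with an exponent that does not depend on \<open>\<delta>\<close>. Hardwiring
  everything but the bits of \<open>j\<close> does not enlarge the circuit, and the result has the Student's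
  proposal as its truth table. After \<open>t\<close> rounds the size is still at most a fixed power of \<open>B\<close>, and
  \<open>\<delta>\<close> is chosen to bring this below \<open>s\<close>.
\<close>

section \<open>Turing machines with an arbitrary finite control\<close>

type_synonym 'q control = "'q \<Rightarrow> nat list \<Rightarrow> 'q option \<times> (nat \<times> direction) list"

fun control_step :: "'q control \<Rightarrow> 'q option \<times> tape list \<Rightarrow> 'q option \<times> tape list" where
  "control_step \<delta> (None, ts) = (None, ts)"
| "control_step \<delta> (Some q, ts) =
     (case \<delta> q (map (\<lambda>f. f 0) ts) of (q', acts) \<Rightarrow> (q', map2 act_on acts ts))"

text \<open>A \<open>tm\<close> starts in state 0, so the numbering of the states has to send the
  given initial state there.\<close>

lemma ex_numbering:
  assumes "finite Q" "q0 \<in> Q"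
  obtains h where "bij_betw h Q {..<card Q}" "h q0 = (0::nat)"
proof -
  obtain g where g: "bij_betw g (Q - {q0}) {..<card (Q - {q0})}"
    using assms(1) ex_bij_betw_finite_nat[of "Q - {q0}"] by (auto simp: atLeast0LessThan)
  define h where "h q = (if q = q0 then 0 else Suc (g q))" for q
  have card: "card Q = Suc (card (Q - {q0}))"
    using assms by (metis card_Suc_Diff1)
  have "inj_on h Q"
    using g by (auto simp: h_def inj_on_def bij_betw_def)
  moreover have "h ` Q = insert 0 (Suc ` g ` (Q - {q0}))"
    using assms(2) by (auto simp: h_def image_iff)
  then have "h ` Q = {..<card Q}"
    using g card by (simp add: bij_betw_def lessThan_Suc_eq_insert_0)
  ultimately have "bij_betw h Q {..<card Q}"
    by (simp add: bij_betw_def)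
  then show thesis
    using that[of h] by (simp add: h_def)
qed

text \<open>Numbering the states turns a control over any type into a \<open>tm\<close>, with
  \<open>None\<close> becoming the halting state \<open>card Q\<close>. The hypothesis
  \<open>closed\<close> ranges over all \<open>v\<close>, so a run stays inside \<open>Q\<close>
  without any invariant about the symbols on the tapes.\<close>

lemma control_realizable:
  fixes \<delta> :: "'q control"
  assumes fin: "finite Q" and q0: "q0 \<in> Q" and K: "1 \<le> K" and G: "4 \<le> G"
    and closed: "\<And>q v. q \<in> Q \<Longrightarrow> set_option (fst (\<delta> q v)) \<subseteq> Q"
    and acts: "\<And>q v. q \<in> Q \<Longrightarrow> length v = K \<Longrightarrow> set v \<subseteq> {..<G} \<Longrightarrow>
      length (snd (\<delta> q v)) = K \<and> fst ` set (snd (\<delta> q v)) \<subseteq> {..<G}"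
  obtains M where "wf_tm M"
    "\<And>w out r T ts. (control_step \<delta> ^^ r) (Some q0, tape_of w # replicate (K - 1) blank_tape) = (None, ts) \<Longrightarrow>
       r \<le> T \<Longrightarrow> tape_shows (hd ts) out \<Longrightarrow> halts_with M w out T"
proof -
  obtain h where h: "bij_betw h Q {..<card Q}" "h q0 = 0"
    using ex_numbering[OF fin q0] .
  define num where "num s = (case s of None \<Rightarrow> card Q | Some q \<Rightarrow> h q)" for s
  define M where "M = \<lparr>tapes = K, states = card Q, symbols = G,
    delta = (\<lambda>q v. case \<delta> (inv_into Q h q) v of (q', acts) \<Rightarrow> (num q', acts))\<rparr>"
  have inv: "inv_into Q h (h q) = q" if "q \<in> Q" for q
    using h(1) that by (simp add: bij_betw_def inv_into_f_f)
  have h_less: "h q < card Q" if "q \<in> Q" for q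
    using h(1) that by (auto simp: bij_betw_def)
  have inv_in: "inv_into Q h q \<in> Q" if "q < card Q" for q
    using h(1) that by (auto simp: bij_betw_def intro: inv_into_into)
  have num_le: "num s \<le> card Q" if "set_option s \<subseteq> Q" for s
    using that h_less by (cases s) (auto simp: num_def less_imp_le)
  have wf: "wf_tm M"
  proof -
    have "num (fst (\<delta> (inv_into Q h q) v)) \<le> card Q \<and>
        length (snd (\<delta> (inv_into Q h q) v)) = K \<and> fst ` set (snd (\<delta> (inv_into Q h q) v)) \<subseteq> {..<G}"
      if "q < card Q" "length v = K" "set v \<subseteq> {..<G}" for q v
      using num_le[OF closed] acts inv_in that by blast
    moreover have "1 \<le> card Q"
      using q0 fin by (auto simp: Suc_le_eq card_gt_0_iff)
    ultimately show ?thesis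
      unfolding wf_tm_def M_def using K G by (simp add: split_beta)
  qed
  have step: "tm_step M (num s, ts) = (num s', ts') \<and> set_option s' \<subseteq> Q"
    if "set_option s \<subseteq> Q" "control_step \<delta> (s, ts) = (s', ts')" for s s' ts ts'
  proof (cases s)
    case None
    then show ?thesis using that by (auto simp: tm_step_def M_def num_def)
  next
    case (Some q)
    then have "q \<in> Q" using that(1) by simp
    then show ?thesis
      using that(2) Some closed[of q "map (\<lambda>f. f 0) ts"] h_less[of q] inv[of q]
      by (auto simp: tm_step_def M_def num_def split: prod.splits)
  qed
  have run: "\<exists>s ts'. (control_step \<delta> ^^ r) (Some q0, ts) = (s, ts') \<and> set_option s \<subseteq> Q \<and>
      (tm_step M ^^ r) (0, ts) = (num s, ts')" for r ts
  proof (induction r)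
    case 0
    then show ?case using q0 h(2) by (simp add: num_def)
  next
    case (Suc r)
    then obtain s ts' where *: "(control_step \<delta> ^^ r) (Some q0, ts) = (s, ts')" "set_option s \<subseteq> Q"
      "(tm_step M ^^ r) (0, ts) = (num s, ts')" by blast
    obtain s'' ts'' where "control_step \<delta> (s, ts') = (s'', ts'')" by fastforce
    then show ?case using * step[of s ts' s'' ts''] by simp
  qed
  show thesis
  proof (rule that[OF wf])
    fix w out r T ts
    assume *: "(control_step \<delta> ^^ r) (Some q0, tape_of w # replicate (K - 1) blank_tape) = (None, ts)"
      "r \<le> T" "tape_shows (hd ts) out"
    have "(tm_step M ^^ r) (0, tape_of w # replicate (K - 1) blank_tape) = (num None, ts)"
      using run[of r "tape_of w # replicate (K - 1) blank_tape"] *(1) by auto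
    then have "(tm_step M ^^ r) (init_config M w) = (states M, ts)"
      by (simp add: init_config_def M_def num_def)
    then show "halts_with M w out T"
      unfolding halts_with_def using *(2,3) by (intro exI[of _ r]) simp
  qed
qed

section \<open>Reachability within a bounded number of steps\<close>

definition reaches :: "'q control \<Rightarrow> nat \<Rightarrow> 'q option \<times> tape list \<Rightarrow> 'q option \<times> tape list \<Rightarrow> bool" where
  "reaches \<delta> n x y \<longleftrightarrow> (\<exists>r\<le>n. (control_step \<delta> ^^ r) x = y)"

lemma reaches_refl: "reaches \<delta> n x x"
  unfolding reaches_def by (intro exI[of _ 0]) simp

lemma reaches_step: "control_step \<delta> x = y \<Longrightarrow> reaches \<delta> 1 x y"
  unfolding reaches_def by (intro exI[of _ 1]) simp

lemma reaches_trans [trans]: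
  assumes "reaches \<delta> m x y" "reaches \<delta> n y z"
  shows "reaches \<delta> (m + n) x z"
proof -
  obtain a b where "a \<le> m" "(control_step \<delta> ^^ a) x = y" "b \<le> n" "(control_step \<delta> ^^ b) y = z"
    using assms unfolding reaches_def by blast
  then show ?thesis
    unfolding reaches_def by (intro exI[of _ "b + a"]) (simp add: funpow_add)
qed

lemma reaches_mono: "reaches \<delta> m x y \<Longrightarrow> m \<le> n \<Longrightarrow> reaches \<delta> n x y"
  unfolding reaches_def using order_trans by blast

lemma reaches_iterate:
  assumes "\<And>i. i < n \<Longrightarrow> reaches \<delta> m (X i) (X (Suc i))"
  shows "reaches \<delta> (n * m) (X 0) (X n)"
  using assms
proof (induction n)
  case 0
  then show ?case by (simp add: reaches_refl)
next
  case (Suc n)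
  then have "reaches \<delta> (n * m + m) (X 0) (X (Suc n))"
    by (intro reaches_trans[of \<delta> "n * m" "X 0" "X n"]) auto
  then show ?case by (simp add: add.commute)
qed


section \<open>Tapes with a head position\<close>

text \<open>The head always scans cell 0, so a head position \<open>p\<close> becomes a shift of the
  tape. In \<open>tape_end\<close> the head scans the blank behind \<open>w\<close>, where writing a
  symbol appends it.\<close>

definition tape_at :: "nat list \<Rightarrow> int \<Rightarrow> tape" where
  "tape_at w p = (\<lambda>i. tape_of w (i + p))"

abbreviation tape_end :: "nat list \<Rightarrow> tape" where
  "tape_end w \<equiv> tape_at w (int (length w))"

lemma tape_at_read: "tape_at w p 0 = (if 0 \<le> p \<and> p < int (length w) then w ! nat p else 0)"
  by (simp add: tape_at_def tape_of_def)

lemma tape_at_eq_0_iff: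
  assumes "0 \<notin> set w"
  shows "tape_at w p 0 = 0 \<longleftrightarrow> p < 0 \<or> int (length w) \<le> p"
  using assms by (auto simp: tape_at_read set_conv_nth nat_less_iff)

lemma act_on_shift: "act_on (f 0, dir) f = (\<lambda>i. f (i + offset dir))"
  by (simp add: act_on_def)

lemma act_on_move: "act_on (tape_at w p 0, dir) (tape_at w p) = tape_at w (p + offset dir)"
  unfolding act_on_shift by (simp add: tape_at_def add.assoc add.commute[of p])

lemma act_on_stay [simp]: "act_on (f 0, Stay) f = f"
  by (simp add: act_on_def)

lemma act_on_append:
  "act_on (x, dir) (tape_end w) = tape_at (w @ [x]) (int (length w) + offset dir)"
  by (auto simp: act_on_def tape_at_def tape_of_def fun_eq_iff nth_append algebra_simps)

lemma blank_tape_eq: "blank_tape = tape_end []"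
  by (auto simp: blank_tape_def tape_at_def tape_of_def fun_eq_iff)

lemma tape_of_eq: "tape_of w = tape_at w 0"
  by (simp add: tape_at_def)

section \<open>A machine that expands its input and runs another machine\<close>

text \<open>The phases of the machine. \<open>Recode r\<close> remembers the input position modulo
  the period, \<open>Carry i\<close> the work head that is being rewound, \<open>Run q\<close> the
  state of the simulated machine.\<close>

datatype ctrl = Init | Recode nat | RewindWork | Odometer | Carry nat | RewindInput | Run nat

definition keep :: "nat list \<Rightarrow> (nat \<times> direction) list" where
  "keep vs = map (\<lambda>v. (v, Stay)) vs"

definition steer :: "(nat \<Rightarrow> direction) \<Rightarrow> nat list \<Rightarrow> (nat \<times> direction) list" where
  "steer D vs = map (\<lambda>i. (vs ! i, D i)) [0..<length vs]"

lemma length_keep [simp]: "length (keep vs) = length vs"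
  by (simp add: keep_def)

lemma length_steer [simp]: "length (steer D vs) = length vs"
  by (simp add: steer_def)

lemma keep_Cons [simp]: "keep (v # vs) = (v, Stay) # keep vs"
  by (simp add: keep_def)

lemma set_keep_iff [simp]: "(v, dir) \<in> set (keep vs) \<longleftrightarrow> v \<in> set vs \<and> dir = Stay"
  by (auto simp: keep_def)

lemma set_steerD: "(v, dir) \<in> set (steer D vs) \<Longrightarrow> v \<in> set vs"
  by (auto simp: steer_def)

lemma act_keep [simp]: "map2 act_on (keep (map (\<lambda>f. f 0) ts)) ts = ts"
  by (induction ts) (simp_all add: keep_def)

lemma act_steer:
  "map2 act_on (steer D (map (\<lambda>p. tape_at w p 0) ps)) (map (tape_at w) ps) =
     map (tape_at w) (map (\<lambda>i. ps ! i + offset (D i)) [0..<length ps])"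
  by (rule nth_equalityI) (simp_all add: steer_def act_on_move)

lemma act_replicate [simp]:
  "map2 act_on (replicate n a) (replicate n f) = replicate n (act_on a f)"
  by (induction n) simp_all

text \<open>
  Symbols of the work tapes: 1 marks the first cell, 2 stands for an input bit 0, and an input bit 1
  at a position congruent to \<open>r\<close> modulo the period becomes \<open>3 + r\<close>. The symbol 3 is the
  base letter; \<open>4 * (l + 1) + a\<close> with \<open>l \<le> c\<close> and \<open>a < 4\<close> is the command to emit \<open>a\<close> as many
  times as there are \<open>l\<close>-tuples of base letters. The heads of the \<open>c + 1\<close> work tapes run
  through all tuples of cells like an odometer; the emitted 1, 2, 3 form the input of the simulated
  machine, and the emitted 0 form a tally that selects a bit of its output.
\<close>

locale expander =
  fixes N :: tm and c :: nat
  assumes wf_N: "wf_tm N"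
begin

text \<open>One residue for the base letter and four for each of the levels \<open>l \<le> c\<close>
  of commands.\<close>

definition period :: nat where
  "period = 4 * c + 5"

text \<open>Behind a command of level \<open>l\<close>, the next \<open>l\<close> heads must scan
  base letters and the remaining ones the marker 1. With \<open>B\<close> base letters and a single
  marker in the word, exactly \<open>B ^ l\<close> positions of these heads qualify.\<close>

definition emitted :: "nat list \<Rightarrow> nat list" where
  "emitted vs =
     (let l = hd vs div 4 - 1 in
      if 4 \<le> hd vs \<and> tl vs = replicate l 3 @ replicate (c - l) 1 then [hd vs mod 4] else [])"

text \<open>The symbol \<open>a\<close> is read on the input tape, which also receives the answer,
  \<open>j\<close> on the tally tape, \<open>vs\<close> on the work tapes, \<open>us\<close> on the
  tapes of \<open>N\<close>. In \<open>Odometer\<close>, \<open>i\<close> counts the leading heads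
  that still scan a letter: \<open>i = 0\<close> ends the enumeration, and
  \<open>i < length vs\<close> asks for a carry into head \<open>i - 1\<close>. \<open>Run\<close>
  tests the symbols and truncates the next state, because \<open>delta N\<close> is constrained only
  on the alphabet and tape number of \<open>N\<close>.\<close>

fun trans :: "ctrl \<Rightarrow> nat \<Rightarrow> nat \<Rightarrow> nat list \<Rightarrow> nat list \<Rightarrow>
    ctrl option \<times> (nat \<times> direction) \<times> (nat \<times> direction) \<times> (nat \<times> direction) list \<times> (nat \<times> direction) list"
where
  "trans Init a j vs us =
     (Some (Recode 0), (a, Stay), (j, Stay), map (\<lambda>v. (1, Rightwards)) vs, keep us)"
| "trans (Recode r) a j vs us =
     (if a = 1 \<or> a = 2
      then (Some (Recode (Suc r mod period)), (a, Rightwards), (j, Stay),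
        map (\<lambda>v. (if a = 2 then 3 + r else 2, Rightwards)) vs, keep us)
      else (Some RewindWork, (a, Stay), (j, Stay), map (\<lambda>v. (v, Leftwards)) vs, keep us))"
| "trans RewindWork a j vs us =
     (if hd vs \<noteq> 0
      then (Some RewindWork, (a, Stay), (j, Stay), map (\<lambda>v. (v, Leftwards)) vs, keep us)
      else (Some Odometer, (a, Stay), (j, Stay), map (\<lambda>v. (v, Rightwards)) vs, keep us))"
| "trans Odometer a j vs us =
     (let i = length (takeWhile (\<lambda>v. v \<noteq> 0) vs) in
      if i = 0
      then (Some RewindInput, (a, Stay), (j, Leftwards), keep vs, (3, Stay) # keep (tl us))
      else if i < length vs
      then (Some (Carry i), (a, Stay), (j, Stay),
        steer (\<lambda>i'. if i' = i then Leftwards else if Suc i' = i then Rightwards else Stay) vs, keep us)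
      else (Some Odometer, (a, Stay), if emitted vs = [0] then (1, Rightwards) else (j, Stay),
        steer (\<lambda>i'. if Suc i' = length vs then Rightwards else Stay) vs,
        if emitted vs = [] \<or> emitted vs = [0] then keep us
        else (hd (emitted vs), Rightwards) # keep (tl us)))"
| "trans (Carry i) a j vs us =
     (if vs ! i \<noteq> 0
      then (Some (Carry i), (a, Stay), (j, Stay),
        steer (\<lambda>i'. if i' = i then Leftwards else Stay) vs, keep us)
      else (Some Odometer, (a, Stay), (j, Stay),
        steer (\<lambda>i'. if i' = i then Rightwards else Stay) vs, keep us))"
| "trans RewindInput a j vs us =
     (if hd us \<noteq> 0
      then (Some RewindInput, (a, Stay), (j, Stay), keep vs, (hd us, Leftwards) # keep (tl us))
      else (Some (Run 0), (a, Stay), (j, Stay), keep vs, (hd us, Rightwards) # keep (tl us)))"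
| "trans (Run q) a j vs us =
     (if q < states N
      then (if set us \<subseteq> {..<symbols N}
        then (Some (Run (min (fst (delta N q us)) (states N))), (a, Stay), (j, Stay), keep vs,
          snd (delta N q us))
        else (None, (a, Stay), (j, Stay), keep vs, keep us))
      else if j \<noteq> 0 \<and> hd us \<noteq> 0
      then (Some (Run q), (a, Stay), (j, Leftwards), keep vs, (hd us, Rightwards) # keep (tl us))
      else (None, (if hd us = 2 then 2 else 1, Stay), (j, Stay), keep vs, keep us))"

definition machine :: "ctrl control" where
  "machine q v =
     (case v of
        a # j # rest \<Rightarrow>
          (case trans q a j (take (Suc c) rest) (drop (Suc c) rest) of
             (q', x, y, xs, ys) \<Rightarrow> (q', x # y # xs @ ys))
      | _ \<Rightarrow> (None, []))"

definition ctrl_states :: "ctrl set" where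
  "ctrl_states = {Init, RewindWork, Odometer, RewindInput} \<union>
     Recode ` {..<period} \<union> Carry ` {..c} \<union> Run ` {..states N}"

text \<open>Recoded symbols go up to \<open>3 + (period - 1) = 4 * c + 7\<close>.\<close>

definition alphabet :: nat where
  "alphabet = max (4 * c + 8) (symbols N)"

lemma machine_closed: "q \<in> ctrl_states \<Longrightarrow> set_option (fst (machine q v)) \<subseteq> ctrl_states"
proof -
  assume q: "q \<in> ctrl_states"
  have "set_option (fst (trans q a j vs us)) \<subseteq> ctrl_states" if "length vs \<le> Suc c" for a j vs us
    using q that by (cases q) (auto simp: ctrl_states_def period_def Let_def)
  then show ?thesis
    by (auto simp: machine_def split: list.split prod.split) (metis fst_conv length_take min.cobounded2 option.set_intros subset_iff)
qed

lemma length_trans: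
  assumes "trans q a j vs us = (q', x, y, xs, ys)"
  shows "length xs = length vs"
  using assms by (cases q) (auto simp: Let_def split: if_splits)

lemma trans_actions:
  assumes "trans q a j vs us = (q', x, y, xs, ys)" "q \<in> ctrl_states"
    and "length us = tapes N" "set (a # j # vs @ us) \<subseteq> {..<alphabet}"
  shows "length ys = tapes N" "fst ` set (x # y # xs @ ys) \<subseteq> {..<alphabet}"
proof -
  obtain u us' where us: "us = u # us'"
    using assms(3) wf_N by (cases us) (auto simp: wf_tm_def)
  have big: "4 * c + 8 \<le> alphabet" "symbols N \<le> alphabet"
    by (auto simp: alphabet_def)
  have em: "emitted vs = [] \<or> (\<exists>b<4. emitted vs = [b])"
    by (auto simp: emitted_def Let_def)
  have run: "length (snd (delta N p us)) = tapes N \<and> fst ` set (snd (delta N p us)) \<subseteq> {..<alphabet}"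
    if "p < states N" "set us \<subseteq> {..<symbols N}" for p
    using wf_N that assms(3) big(2) unfolding wf_tm_def by (auto simp: split_beta dest!: spec[of _ p]) force
  have "length ys = tapes N \<and> fst ` set (x # y # xs @ ys) \<subseteq> {..<alphabet}"
  proof (cases q)
    case (Run p)
    then show ?thesis
      using assms run[of p] us big by (auto split: if_splits)
  next
    case Odometer
    then show ?thesis
      using assms em us big by (auto simp: Let_def dest!: set_steerD split: if_splits)
  qed (use assms us big in \<open>auto simp: ctrl_states_def period_def dest!: set_steerD split: if_splits\<close>)
  then show "length ys = tapes N" "fst ` set (x # y # xs @ ys) \<subseteq> {..<alphabet}"
    by auto
qed

lemma machine_realizable:
  obtains M where "wf_tm M"
    "\<And>w out T ts. reaches machine T
        (Some Init, tape_of w # replicate (2 + c + tapes N) blank_tape) (None, ts) \<Longrightarrow>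
      tape_shows (hd ts) out \<Longrightarrow> halts_with M w out T"
proof -
  define K where "K = 3 + c + tapes N"
  have acts: "length (snd (machine q v)) = K \<and> fst ` set (snd (machine q v)) \<subseteq> {..<alphabet}"
    if q: "q \<in> ctrl_states" and K: "length v = K" and v_set: "set v \<subseteq> {..<alphabet}" for q v
  proof -
    obtain a j rest where v: "v = a # j # rest"
      using K by (cases v; cases "tl v") (auto simp: K_def)
    define vs us where "vs = take (Suc c) rest" and "us = drop (Suc c) rest"
    obtain q' x y xs ys where t: "trans q a j vs us = (q', x, y, xs, ys)"
      by (cases "trans q a j vs us") auto
    have len: "length vs = Suc c" "length us = tapes N"
      using K v by (auto simp: vs_def us_def K_def)
    have "set (a # j # vs @ us) \<subseteq> {..<alphabet}"
      using v_set v by (simp add: vs_def us_def)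
    from trans_actions[OF t q len(2) this] length_trans[OF t] t len v show ?thesis
      by (simp add: machine_def vs_def us_def K_def)
  qed
  have init: "finite ctrl_states" "Init \<in> ctrl_states" "1 \<le> K" "4 \<le> alphabet"
    by (auto simp: ctrl_states_def K_def alphabet_def)
  show thesis
  proof (rule control_realizable[OF init machine_closed acts])
    fix M
    assume M: "wf_tm M"
      "\<And>w out r T ts. (control_step machine ^^ r) (Some Init, tape_of w # replicate (K - 1) blank_tape) = (None, ts) \<Longrightarrow>
         r \<le> T \<Longrightarrow> tape_shows (hd ts) out \<Longrightarrow> halts_with M w out T"
    show thesis
      by (rule that[OF M(1)]) (use M(2) in \<open>auto simp: reaches_def K_def\<close>)
  qed
qed

lemma machine_step:
  assumes "length ws = Suc c"
    and "(case trans q (f 0) (g 0) (map (\<lambda>f. f 0) ws) (map (\<lambda>f. f 0) ts) of (q', x, y, xs, ys) \<Rightarrow>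
      (q', act_on x f # act_on y g # map2 act_on xs ws @ map2 act_on ys ts)) = s'"
  shows "reaches machine 1 (Some q, f # g # ws @ ts) s'"
  using assms length_trans
  by (intro reaches_step) (force simp: machine_def split: prod.splits)


section \<open>Recoding, rewinding and the odometer\<close>

primrec recode :: "nat \<Rightarrow> bool list \<Rightarrow> nat list" where
  "recode r [] = []"
| "recode r (b # x) = (if b then 3 + r else 2) # recode (Suc r mod period) x"

lemma period_pos [simp]: "0 < period"
  by (simp add: period_def)

lemma length_recode [simp]: "length (recode r x) = length x"
  by (induction x arbitrary: r) simp_all

lemma zero_notin_recode [simp]: "0 \<notin> set (recode r x)"
  by (induction x arbitrary: r) auto

lemma recode_append:
  "r < period \<Longrightarrow> recode r (x @ y) = recode r x @ recode ((r + length x) mod period) y"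
  by (induction x arbitrary: r) (simp_all add: mod_simps)

text \<open>Induction on the unread part \<open>x2\<close>, each step moving its first bit over to
  \<open>x1\<close>.\<close>

lemma recode_run:
  "reaches machine (length x2)
    (Some (Recode (length x1 mod period)), tape_at (bits_word (x1 @ x2)) (int (length x1)) # g #
       replicate (Suc c) (tape_end (1 # recode 0 x1)) @ ts)
    (Some (Recode (length (x1 @ x2) mod period)), tape_end (bits_word (x1 @ x2)) # g #
       replicate (Suc c) (tape_end (1 # recode 0 (x1 @ x2))) @ ts)"
proof (induction x2 arbitrary: x1)
  case Nil
  then show ?case by (simp add: reaches_refl bits_word_def)
next
  case (Cons b x2)
  let ?y = "bits_word (x1 @ b # x2)"
  have read: "tape_at ?y (int (length x1)) 0 = (if b then 2 else 1)"
    by (simp add: tape_at_read bits_word_def nth_append)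
  have move: "act_on (if b then 2 else 1, Rightwards) (tape_at ?y (int (length x1))) =
      tape_at ?y (int (length x1) + 1)"
    using act_on_move[of ?y "int (length x1)" Rightwards] unfolding read by simp
  have append: "act_on (x, Rightwards) (tape_end (1 # recode 0 x1)) =
      tape_end (1 # recode 0 x1 @ [x])" for x
    using act_on_append[of x Rightwards "1 # recode 0 x1"] by (simp add: algebra_simps)
  have "reaches machine 1
    (Some (Recode (length x1 mod period)), tape_at ?y (int (length x1)) # g #
       replicate (Suc c) (tape_end (1 # recode 0 x1)) @ ts)
    (Some (Recode (length (x1 @ [b]) mod period)), tape_at ?y (int (length (x1 @ [b]))) # g #
       replicate (Suc c) (tape_end (1 # recode 0 (x1 @ [b]))) @ ts)"
    using move append
    by (intro machine_step) (auto simp: read recode_append mod_simps algebra_simps simp del: replicate_Suc)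
  from reaches_trans[OF this, of "length x2"] Cons.IH[of "x1 @ [b]"] show ?case
    by simp
qed

text \<open>As \<open>w\<close> has no blank inside, the first blank met on the way left is the cell
  before the word, and one step right leads to cell 0. Starting from \<open>n - 1\<close> puts that
  blank at the base case \<open>n = 0\<close>.\<close>

lemma rewind_work:
  assumes "0 \<notin> set w" "n \<le> length w"
  shows "reaches machine (n + 1)
    (Some RewindWork, f # g # replicate (Suc c) (tape_at w (int n - 1)) @ ts)
    (Some Odometer, f # g # replicate (Suc c) (tape_at w 0) @ ts)"
  using assms(2)
proof (induction n)
  case 0
  have "act_on (0, Rightwards) (tape_at w (- 1)) = tape_at w 0"
    using act_on_move[of w "- 1" Rightwards] by (simp add: tape_at_read)
  then show ?case
    by (intro machine_step[THEN reaches_mono]) (simp_all add: tape_at_read)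
next
  case (Suc n)
  have "tape_at w (int n) 0 \<noteq> 0"
    using Suc.prems assms(1) by (simp add: tape_at_eq_0_iff)
  then have "reaches machine 1
    (Some RewindWork, f # g # replicate (Suc c) (tape_at w (int (Suc n) - 1)) @ ts)
    (Some RewindWork, f # g # replicate (Suc c) (tape_at w (int n - 1)) @ ts)"
    by (intro machine_step) (simp_all add: act_on_move)
  from reaches_trans[OF this Suc.IH] Suc.prems show ?case
    by simp
qed

lemma rewind_input:
  assumes "0 \<notin> set w" "n \<le> length w" "length ws = Suc c"
  shows "reaches machine (n + 1)
    (Some RewindInput, f # g # ws @ tape_at w (int n - 1) # ts)
    (Some (Run 0), f # g # ws @ tape_at w 0 # ts)"
  using assms(2)
proof (induction n)
  case 0
  have "act_on (0, Rightwards) (tape_at w (- 1)) = tape_at w 0"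
    using act_on_move[of w "- 1" Rightwards] by (simp add: tape_at_read)
  then show ?case
    by (intro machine_step[THEN reaches_mono] assms) (simp_all add: tape_at_read)
next
  case (Suc n)
  have "tape_at w (int n) 0 \<noteq> 0"
    using Suc.prems assms(1) by (simp add: tape_at_eq_0_iff)
  then have "reaches machine 1
    (Some RewindInput, f # g # ws @ tape_at w (int (Suc n) - 1) # ts)
    (Some RewindInput, f # g # ws @ tape_at w (int n - 1) # ts)"
    by (intro machine_step assms) (simp_all add: act_on_move)
  from reaches_trans[OF this Suc.IH] Suc.prems show ?case
    by simp
qed

lemma rewind_carry:
  assumes "0 \<notin> set w" "n \<le> length w" "length ps = Suc c" "i \<le> c"
  shows "reaches machine (n + 1)
    (Some (Carry i), f # g # map (tape_at w) (ps[i := int n - 1]) @ ts)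
    (Some Odometer, f # g # map (tape_at w) (ps[i := 0]) @ ts)"
  using assms(2)
proof (induction n)
  case 0
  have "tape_at w (- 1) 0 = 0"
    by (simp add: tape_at_read)
  moreover have "map (\<lambda>i'. ps[i := - 1] ! i' + offset (if i' = i then Rightwards else Stay)) [0..<Suc c] = ps[i := 0]"
    using assms(3,4) by (intro nth_equalityI) (auto simp: nth_list_update simp del: upt_Suc)
  ultimately show ?case
    using assms(3,4)
    by (intro machine_step[THEN reaches_mono])
      (simp_all add: act_steer comp_def del: upt_Suc)
next
  case (Suc n)
  have "tape_at w (int n) 0 \<noteq> 0"
    using Suc.prems assms(1) by (simp add: tape_at_eq_0_iff)
  moreover have "map (\<lambda>i'. ps[i := int n] ! i' + offset (if i' = i then Leftwards else Stay)) [0..<Suc c] =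
      ps[i := int n - 1]"
    using assms(3,4) by (intro nth_equalityI) (auto simp: nth_list_update simp del: upt_Suc)
  ultimately have "reaches machine 1
    (Some (Carry i), f # g # map (tape_at w) (ps[i := int (Suc n) - 1]) @ ts)
    (Some (Carry i), f # g # map (tape_at w) (ps[i := int n - 1]) @ ts)"
    using assms(3,4)
    by (intro machine_step) (simp_all add: act_steer comp_def del: upt_Suc)
  from reaches_trans[OF this Suc.IH] Suc.prems show ?case
    by simp
qed

text \<open>Here \<open>e\<close> is everything emitted so far: its zeros are counted on the tally
  tape, its other letters form the word on the first tape of \<open>N\<close>.\<close>

definition tally_tape :: "nat list \<Rightarrow> tape" where
  "tally_tape e = tape_end (replicate (length (filter (\<lambda>a. a = 0) e)) 1)"

definition input_tape :: "nat list \<Rightarrow> tape" where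
  "input_tape e = tape_end (filter (\<lambda>a. a \<noteq> 0) e)"

lemma tally_tape_append: "act_on (1, Rightwards) (tally_tape e) = tally_tape (e @ [0])"
  using act_on_append[of 1 Rightwards "replicate (length (filter (\<lambda>a. a = 0) e)) 1"]
  by (simp add: tally_tape_def replicate_append_same algebra_simps)

lemma input_tape_append: "a \<noteq> 0 \<Longrightarrow> act_on (a, Rightwards) (input_tape e) = input_tape (e @ [a])"
  using act_on_append[of a Rightwards "filter (\<lambda>a. a \<noteq> 0) e"]
  by (simp add: input_tape_def algebra_simps)

lemma tally_tape_nonzero: "a \<noteq> 0 \<Longrightarrow> tally_tape (e @ [a]) = tally_tape e"
  by (simp add: tally_tape_def)

lemma input_tape_zero: "input_tape (e @ [0]) = input_tape e"
  by (simp add: input_tape_def)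

text \<open>All heads scan letters, so one tuple is processed. The last head may thereby leave the
  word, which triggers a carry in the next step.\<close>

lemma odometer_emit:
  assumes "0 \<notin> set w" "length ps = c" "\<forall>p \<in> set (ps @ [p]). 0 \<le> p \<and> p < int (length w)"
  shows "reaches machine 1
    (Some Odometer, f # tally_tape e # map (tape_at w) (ps @ [p]) @ input_tape e # ts)
    (Some Odometer, f # tally_tape (e @ emitted (map (\<lambda>p. w ! nat p) (ps @ [p]))) #
       map (tape_at w) (ps @ [p + 1]) @
       input_tape (e @ emitted (map (\<lambda>p. w ! nat p) (ps @ [p]))) # ts)"
proof -
  define vs where "vs = map (\<lambda>p. w ! nat p) (ps @ [p])"
  have vs: "map (\<lambda>p. tape_at w p 0) (ps @ [p]) = vs"
    using assms(3) by (auto simp: vs_def tape_at_read)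
  have "0 \<notin> set vs"
    using assms(1,3) unfolding vs[symmetric] by (auto simp: tape_at_eq_0_iff dest!: sym[of 0])
  then have tw: "takeWhile (\<lambda>v. v \<noteq> 0) vs = vs"
    unfolding takeWhile_eq_all_conv by metis
  have len: "length vs = Suc c"
    using assms(2) by (simp add: vs_def)
  have em: "emitted vs = [] \<or> emitted vs = [0] \<or> (\<exists>b. b \<noteq> 0 \<and> emitted vs = [b])"
    by (auto simp: emitted_def Let_def)
  have "map (\<lambda>i. (ps @ [p]) ! i + offset (if Suc i = Suc c then Rightwards else Stay)) [0..<Suc c] = ps @ [p + 1]"
    using assms(2) by (intro nth_equalityI) (auto simp: nth_append simp del: upt_Suc)
  then have steer: "map2 act_on (steer (\<lambda>i. if Suc i = Suc c then Rightwards else Stay) vs) (map (tape_at w) (ps @ [p])) =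
      map (tape_at w) (ps @ [p + 1])"
    unfolding vs[symmetric] act_steer using assms(2) by simp
  have em_tally: "act_on (if emitted vs = [0] then (1, Rightwards) else (tally_tape e 0, Stay)) (tally_tape e) =
      tally_tape (e @ emitted vs)"
    using em tally_tape_append[of e] by (elim disjE exE) (simp_all add: tally_tape_nonzero)
  have em_input: "map2 act_on (if emitted vs = [] \<or> emitted vs = [0] then keep (map (\<lambda>f. f 0) (input_tape e # ts))
        else (hd (emitted vs), Rightwards) # keep (tl (map (\<lambda>f. f 0) (input_tape e # ts)))) (input_tape e # ts) =
      input_tape (e @ emitted vs) # ts"
    using em by (elim disjE exE) (simp_all add: input_tape_zero input_tape_append)
  show ?thesis
    unfolding vs_def[symmetric]
  proof (rule machine_step)
    have *: "map (\<lambda>f. f 0) (map (tape_at w) (ps @ [p])) = vs"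
      using vs by (simp add: comp_def)
    show "(case trans Odometer (f 0) (tally_tape e 0) (map (\<lambda>f. f 0) (map (tape_at w) (ps @ [p])))
         (map (\<lambda>f. f 0) (input_tape e # ts)) of
       (q', x, y, xs, ys) \<Rightarrow>
         (q', act_on x f # act_on y (tally_tape e) #
            map2 act_on xs (map (tape_at w) (ps @ [p])) @ map2 act_on ys (input_tape e # ts))) =
     (Some Odometer, f # tally_tape (e @ emitted vs) # map (tape_at w) (ps @ [p + 1]) @
        input_tape (e @ emitted vs) # ts)"
      unfolding * trans.simps Let_def tw len
      by (simp only: em_tally em_input steer prod.case act_on_stay nat.distinct less_irrefl if_False)
  qed (use assms(2) in simp)
qed

text \<open>One step advances the head before the exhausted one, and \<open>rewind_carry\<close>
  needs at most \<open>length w + 1\<close> more. If \<open>p + 1\<close> is itself past the end,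
  the next carry happens one tape further left.\<close>

lemma odometer_carry:
  assumes "0 \<notin> set w" "length ps + 2 + n = Suc c" "\<forall>p \<in> set (ps @ [p]). 0 \<le> p \<and> p < int (length w)"
  shows "reaches machine (length w + 2)
    (Some Odometer, f # g # map (tape_at w) (ps @ p # int (length w) # replicate n 0) @ ts)
    (Some Odometer, f # g # map (tape_at w) (ps @ (p + 1) # 0 # replicate n 0) @ ts)"
proof -
  define qs where "qs = ps @ p # int (length w) # replicate n 0"
  define qs' where "qs' = ps @ (p + 1) # 0 # replicate n 0"
  define i where "i = Suc (length ps)"
  have nz: "takeWhile (\<lambda>v. v \<noteq> 0) (map (\<lambda>p. tape_at w p 0) ps) = map (\<lambda>p. tape_at w p 0) ps"
    using assms(1,3) by (fastforce simp: takeWhile_eq_all_conv tape_at_eq_0_iff simp del: neq0_conv)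
  have i: "length (takeWhile (\<lambda>v. v \<noteq> 0) (map (\<lambda>p. tape_at w p 0) qs)) = i"
    using assms(1,3) nz[THEN takeWhile_eq_all_conv[THEN iffD1]]
    by (auto simp: qs_def i_def takeWhile_append tape_at_eq_0_iff nz simp del: neq0_conv)
  have len: "length qs = Suc c" "length qs' = Suc c" "0 < i" "i < Suc c"
    using assms(2) by (auto simp: qs_def qs'_def i_def)
  have "map (\<lambda>i'. qs ! i' + offset (if i' = i then Leftwards else if Suc i' = i then Rightwards else Stay)) [0..<Suc c] =
      qs'[i := int (length w) - 1]"
    using len assms(2)
    by (intro nth_equalityI)
      (auto simp: qs_def qs'_def i_def nth_append nth_list_update nth_Cons' simp del: upt_Suc)
  then have "reaches machine 1 (Some Odometer, f # g # map (tape_at w) qs @ ts)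
      (Some (Carry i), f # g # map (tape_at w) (qs'[i := int (length w) - 1]) @ ts)"
    using len i by (intro machine_step) (simp_all add: comp_def act_steer del: upt_Suc)
  moreover have "reaches machine (length w + 1)
      (Some (Carry i), f # g # map (tape_at w) (qs'[i := int (length w) - 1]) @ ts)
      (Some Odometer, f # g # map (tape_at w) (qs'[i := 0]) @ ts)"
    using len by (intro rewind_carry assms) auto
  moreover have "qs'[i := 0] = qs'"
    by (simp add: qs'_def i_def list_update_append)
  ultimately show ?thesis
    unfolding qs_def[symmetric] qs'_def[symmetric] using reaches_trans by fastforce
qed


text \<open>The list \<open>u\<close> holds the letters under the heads already fixed, and
  \<open>n\<close> heads have yet to run through \<open>w\<close>.\<close>

fun emission :: "nat list \<Rightarrow> nat list \<Rightarrow> nat \<Rightarrow> nat list" where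
  "emission w u 0 = emitted u"
| "emission w u (Suc n) = concat (map (\<lambda>a. emission w (u @ [a]) n) w)"

fun odometer_time :: "nat \<Rightarrow> nat \<Rightarrow> nat" where
  "odometer_time K 0 = 1"
| "odometer_time K (Suc n) = K * odometer_time K n + (K + 2)"

text \<open>Induction on the number of inner heads. Each letter under the next head costs one full
  inner loop; then a carry resets that head and advances \<open>p\<close>.\<close>

lemma odometer_loop:
  assumes "0 \<notin> set w" "length ps + n = c" "\<forall>p \<in> set (ps @ [p]). 0 \<le> p \<and> p < int (length w)"
  shows "reaches machine (odometer_time (length w) n)
    (Some Odometer, f # tally_tape e # map (tape_at w) (ps @ p # replicate n 0) @ input_tape e # ts)
    (Some Odometer, f # tally_tape (e @ emission w (map (\<lambda>p. w ! nat p) (ps @ [p])) n) #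
       map (tape_at w) (ps @ (p + 1) # replicate n 0) @
       input_tape (e @ emission w (map (\<lambda>p. w ! nat p) (ps @ [p])) n) # ts)"
  using assms(2,3)
proof (induction n arbitrary: ps p e)
  case 0
  then show ?case
    using odometer_emit[OF assms(1), of ps p f e ts] by simp
next
  case (Suc n)
  define u where "u = map (\<lambda>p. w ! nat p) (ps @ [p])"
  define es where "es i = e @ concat (map (\<lambda>a. emission w (u @ [a]) n) (take i w))" for i
  define X where "X i = (Some Odometer, f # tally_tape (es i) #
    map (tape_at w) ((ps @ [p]) @ int i # replicate n 0) @ input_tape (es i) # ts)" for i
  have "reaches machine (odometer_time (length w) n) (X i) (X (Suc i))" if "i < length w" for i
  proof -
    have es: "es (Suc i) = es i @ emission w (u @ [w ! i]) n"
      using that by (simp add: es_def take_Suc_conv_app_nth)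
    show ?thesis
      using Suc.IH[of "ps @ [p]" "int i" "es i"] Suc.prems that
      by (simp add: X_def es u_def add.commute)
  qed
  then have "reaches machine (length w * odometer_time (length w) n) (X 0) (X (length w))"
    by (rule reaches_iterate)
  moreover have "reaches machine (length w + 2) (X (length w))
    (Some Odometer, f # tally_tape (es (length w)) #
       map (tape_at w) (ps @ (p + 1) # 0 # replicate n 0) @ input_tape (es (length w)) # ts)"
    using odometer_carry[OF assms(1), of ps n p] Suc.prems by (simp add: X_def)
  ultimately show ?case
    using reaches_trans by (fastforce simp: X_def es_def u_def)
qed

text \<open>The first head has no left neighbour to carry into, so the loop ends with it on the
  blank behind the word.\<close>

lemma odometer_run:
  assumes "0 \<notin> set w"
  shows "reaches machine (length w * odometer_time (length w) c)
    (Some Odometer, f # tally_tape [] # replicate (Suc c) (tape_at w 0) @ input_tape [] # ts)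
    (Some Odometer, f # tally_tape (emission w [] (Suc c)) #
       (tape_end w # replicate c (tape_at w 0)) @ input_tape (emission w [] (Suc c)) # ts)"
proof -
  define es where "es i = concat (map (\<lambda>a. emission w [a] c) (take i w))" for i
  define X where "X i = (Some Odometer, f # tally_tape (es i) #
    map (tape_at w) (int i # replicate c 0) @ input_tape (es i) # ts)" for i
  have "reaches machine (odometer_time (length w) c) (X i) (X (Suc i))" if "i < length w" for i
  proof -
    have es: "es (Suc i) = es i @ emission w [w ! i] c"
      using that by (simp add: es_def take_Suc_conv_app_nth)
    show ?thesis
      using odometer_loop[OF assms, of "[]" c "int i" f "es i" ts] that
      by (simp add: X_def es add.commute)
  qed
  then have "reaches machine (length w * odometer_time (length w) c) (X 0) (X (length w))"
    by (rule reaches_iterate)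
  then show ?thesis
    by (simp add: X_def es_def)
qed

text \<open>The symbol 3 written here closes the last component of the tuple, and the tally head
  steps back onto the last mark.\<close>

lemma odometer_exit:
  "reaches machine 1
    (Some Odometer, f # tally_tape e # (tape_end w # replicate c g) @ input_tape e # ts)
    (Some RewindInput, f # tape_at (replicate (length (filter (\<lambda>a. a = 0) e)) 1)
         (int (length (filter (\<lambda>a. a = 0) e)) - 1) #
       (tape_end w # replicate c g) @
       tape_at (filter (\<lambda>a. a \<noteq> 0) e @ [3]) (int (length (filter (\<lambda>a. a \<noteq> 0) e))) # ts)"
proof (rule machine_step)
  have "tape_end w 0 = 0"
    by (simp add: tape_at_read)
  then show "(case trans Odometer (f 0) (tally_tape e 0) (map (\<lambda>f. f 0) (tape_end w # replicate c g))
       (map (\<lambda>f. f 0) (input_tape e # ts)) of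
     (q', x, y, xs, ys) \<Rightarrow> (q', act_on x f # act_on y (tally_tape e) #
        map2 act_on xs (tape_end w # replicate c g) @ map2 act_on ys (input_tape e # ts))) =
     (Some RewindInput, f # tape_at (replicate (length (filter (\<lambda>a. a = 0) e)) 1)
         (int (length (filter (\<lambda>a. a = 0) e)) - 1) #
       (tape_end w # replicate c g) @
       tape_at (filter (\<lambda>a. a \<noteq> 0) e @ [3]) (int (length (filter (\<lambda>a. a \<noteq> 0) e))) # ts)"
    using act_keep[of "tape_end w # replicate c g"] act_on_append[of 3 Stay "filter (\<lambda>a. a \<noteq> 0) e"]
    by (simp add: tally_tape_def input_tape_def act_on_move)
qed simp

section \<open>Simulation of \<open>N\<close> and selection of one output bit\<close>

lemma simulation_run:
  assumes ws: "length ws = Suc c"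
    and ts: "length ts = tapes N" "\<forall>t \<in> set ts. \<forall>i. t i < symbols N"
    and run: "(tm_step N ^^ r) (0, ts) = (q', ts')"
  shows "reaches machine r (Some (Run 0), f # g # ws @ ts) (Some (Run q'), f # g # ws @ ts') \<and>
    q' \<le> states N \<and> length ts' = tapes N \<and> (\<forall>t \<in> set ts'. \<forall>i. t i < symbols N)"
  using run
proof (induction r arbitrary: q' ts')
  case 0
  then show ?case using ts by (simp add: reaches_refl)
next
  case (Suc r)
  obtain q us where r: "(tm_step N ^^ r) (0, ts) = (q, us)" by fastforce
  note IH = Suc.IH[OF r]
  have st: "tm_step N (q, us) = (q', ts')"
    using Suc.prems r by simp
  show ?case
  proof (cases "q < states N")
    case False
    then show ?thesis
      using IH st reaches_mono[of machine r] by (auto simp: tm_step_def)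
  next
    case True
    define vs where "vs = map (\<lambda>f. f 0) us"
    have vs: "length vs = tapes N" "set vs \<subseteq> {..<symbols N}"
      using IH by (auto simp: vs_def)
    obtain acts where d: "delta N q vs = (q', acts)" "ts' = map2 act_on acts us"
      using st True by (auto simp: tm_step_def vs_def split: prod.splits)
    have wf: "q' \<le> states N" "length acts = tapes N" "fst ` set acts \<subseteq> {..<symbols N}"
      using wf_N vs True d(1) unfolding wf_tm_def by fastforce+
    \<comment> \<open>Preserving the symbol bound keeps the alphabet test in \<open>trans\<close>
      true at the next step.\<close>
    have bound: "t i < symbols N" if "t \<in> set ts'" for t i
    proof -
      obtain k where "k < length ts'" "ts' ! k = t"
        using \<open>t \<in> set ts'\<close> by (metis in_set_conv_nth)
      then have "t = act_on (acts ! k) (us ! k)" "acts ! k \<in> set acts" "us ! k \<in> set us"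
        using d(2) by auto
      then show ?thesis
        using wf(3) IH by (auto simp: act_on_def)
    qed
    have "reaches machine 1 (Some (Run q), f # g # ws @ us) (Some (Run q'), f # g # ws @ ts')"
      using True d vs wf(1) by (intro machine_step ws) (simp add: vs_def min_absorb1)
    from reaches_trans[OF conjunct1[OF IH] this] show ?thesis
      using IH wf d(2) bound by simp
  qed
qed

text \<open>One tally mark is passed per output letter, for \<open>min j (length out)\<close> steps.
  An index beyond the output leaves the head on a blank, which is answered by the bit 0. By
  \<open>f 1 = 0\<close> the one-letter answer ends after cell 0.\<close>

lemma walk_run:
  assumes ws: "length ws = Suc c" and t: "tape_shows t (bits_word out)"
    and f: "f 1 = 0"
  shows "\<exists>ts'. reaches machine (j + 1)
      (Some (Run (states N)), f # tape_at (replicate j 1) (int j - 1) # ws @ t # ts) (None, ts') \<and>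
    tape_shows (hd ts') (bits_word [j < length out \<and> out ! j])"
proof -
  have t_read: "t (int i) = (if i < length out then if out ! i then 2 else 1 else 0)" if "i \<le> length out" for i
    using t that by (auto simp: tape_shows_def bits_word_def)
  define X where "X i = (Some (Run (states N)), f # tape_at (replicate j 1) (int j - 1 - int i) #
    ws @ (\<lambda>p. t (p + int i)) # ts)" for i
  define l where "l = min j (length out)"
  have j_read: "tape_at (replicate j 1) (int j - 1 - int i) 0 = (if i < j then 1 else 0)" for i
    by (auto simp: tape_at_read nat_less_iff)
  have "reaches machine 1 (X i) (X (Suc i))" if "i < l" for i
  proof -
    have "act_on (Suc 0, Leftwards) (tape_at (replicate j (Suc 0)) (int j - 1 - int i)) =
        tape_at (replicate j (Suc 0)) (int j - 1 - int (Suc i))"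
      using act_on_move[of "replicate j 1" "int j - 1 - int i" Leftwards] j_read[of i] that
      by (simp add: l_def algebra_simps)
    then show ?thesis
      unfolding X_def using that j_read[of i] t_read[of i] act_on_shift[of "\<lambda>p. t (p + int i)" Rightwards]
      by (intro machine_step ws) (auto simp: l_def algebra_simps)
  qed
  then have to_end: "reaches machine (l * 1) (X 0) (X l)"
    by (rule reaches_iterate)
  have "reaches machine 1 (X l) (None, act_on (if j < length out \<and> out ! j then 2 else 1, Stay) f #
      tape_at (replicate j 1) (int j - 1 - int l) # ws @ (\<lambda>p. t (p + int l)) # ts)"
  proof -
    have "\<not> (tape_at (replicate j 1) (int j - 1 - int l) 0 \<noteq> 0 \<and> t (int l) \<noteq> 0)"
      using t_read[of l] j_read[of l] by (auto simp: l_def min_def)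
    moreover have "t (int l) = 2 \<longleftrightarrow> j < length out \<and> out ! j"
      using t_read[of l] by (auto simp: l_def min_def)
    ultimately show ?thesis
      unfolding X_def using act_on_stay[of "\<lambda>p. t (p + int l)"]
      by (intro machine_step ws) (simp del: neq0_conv)
  qed
  from reaches_trans[OF to_end this] have "reaches machine (j + 1) (X 0)
      (None, act_on (if j < length out \<and> out ! j then 2 else 1, Stay) f #
      tape_at (replicate j 1) (int j - 1 - int l) # ws @ (\<lambda>p. t (p + int l)) # ts)"
    by (rule reaches_mono) (simp add: l_def)
  then show ?thesis
    using f by (intro exI conjI) (auto simp: X_def tape_shows_def bits_word_def act_on_def)
qed

end

lemma poly_nat_mono: "x \<le> y \<Longrightarrow> poly p x \<le> poly p y" for p :: "nat poly"
  by (induction p) (auto intro!: add_mono mult_mono)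

text \<open>Membership in P requires halting in time on all inputs, while \<open>N\<close> is known
  to halt only on tuple words. By this lemma every expanded input is such a word.\<close>

lemma ex_tuple_word:
  assumes "set w \<subseteq> {1, 2, 3}"
  shows "\<exists>xs. tuple_word xs = w @ [3]"
  using assms
proof (induction w)
  case Nil
  show ?case
    by (rule exI[of _ "[[]]"]) (simp add: tuple_word_def bits_word_def)
next
  case (Cons a w)
  then obtain xs where xs: "tuple_word xs = w @ [3]" by auto
  then obtain x ys where ys: "xs = x # ys"
    by (cases xs) (auto simp: tuple_word_def)
  have "tuple_word ([] # xs) = 3 # w @ [3]" "tuple_word ((True # x) # ys) = 2 # w @ [3]"
    "tuple_word ((False # x) # ys) = 1 # w @ [3]"
    using xs ys by (simp_all add: tuple_word_def bits_word_def)
  then show ?case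
    using Cons.prems by (auto simp: numeral_3_eq_3 numeral_2_eq_2)
qed

text \<open>Reading up to the first separator recovers the first component. This makes the tuple
  \<open>ys\<close> in the decided language unique.\<close>

lemma tuple_word_inj: "tuple_word xs = tuple_word ys \<Longrightarrow> xs = ys"
proof (induction xs arbitrary: ys)
  case Nil
  then show ?case by (cases ys) (auto simp: tuple_word_def)
next
  case (Cons x xs)
  then obtain y ys' where ys: "ys = y # ys'"
    by (cases ys) (auto simp: tuple_word_def)
  have no3: "\<forall>a \<in> set (bits_word z). a \<noteq> 3" for z
    by (auto simp: bits_word_def)
  have eq: "bits_word x @ 3 # tuple_word xs = bits_word y @ 3 # tuple_word ys'"
    using Cons.prems by (simp add: ys tuple_word_def)
  have "takeWhile (\<lambda>a. a \<noteq> 3) (bits_word z @ 3 # v) = bits_word z" for z v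
    using no3[of z] by (simp add: takeWhile_append2)
  with eq have bw: "bits_word x = bits_word y"
    by metis
  have "inj (\<lambda>b. if b then 2 else 1 :: nat)"
    by (auto simp: inj_def split: if_splits)
  with bw have "x = y"
    unfolding bits_word_def by (simp add: inj_map_eq_map)
  moreover have "xs = ys'"
    using eq bw Cons.IH by simp
  ultimately show ?case by (simp add: ys)
qed

context expander
begin

definition work_word :: "bool list \<Rightarrow> nat list" where
  "work_word x = 1 # recode 0 x"

definition expansion :: "bool list \<Rightarrow> nat list" where
  "expansion x = emission (work_word x) [] (Suc c)"

definition expanded_input :: "bool list \<Rightarrow> nat list" where
  "expanded_input x = filter (\<lambda>a. a \<noteq> 0) (expansion x) @ [3]"

definition expanded_index :: "bool list \<Rightarrow> nat" where
  "expanded_index x = length (filter (\<lambda>a. a = 0) (expansion x))"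

lemma machine_run:
  fixes x :: "bool list"
  defines "K \<equiv> Suc (length x)"
  assumes halt: "halts_with N (expanded_input x) (bits_word out) T"
    and small: "set (expansion x) \<subseteq> {..<4}"
  shows "\<exists>ts. reaches machine
      (4 + 2 * K + K * odometer_time K c + length (expanded_input x) + 1 + T + expanded_index x + 1)
      (Some Init, tape_of (bits_word x) # replicate (2 + c + tapes N) blank_tape) (None, ts) \<and>
    tape_shows (hd ts) (bits_word [expanded_index x < length out \<and> out ! expanded_index x])"
proof -
  define w where "w = work_word x"
  define e where "e = expansion x"
  define j where "j = expanded_index x"
  define W where "W = expanded_input x"
  define f where "f = tape_end (bits_word x)"
  define blanks where "blanks = replicate (tapes N - 1) blank_tape"
  define ws where "ws = tape_end w # replicate c (tape_at w 0)"
  define g where "g = tape_at (replicate j 1) (int j - 1)"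
  have N: "1 \<le> tapes N" "4 \<le> symbols N"
    using wf_N by (auto simp: wf_tm_def)
  have w: "0 \<notin> set w" "length w = K"
    by (auto simp: w_def work_word_def K_def)
  have W: "0 \<notin> set W" "set W \<subseteq> {..<4}"
    using small by (auto simp: W_def expanded_input_def)
  have blanks: "replicate (tapes N) blank_tape = blank_tape # blanks"
    using N(1) by (cases "tapes N") (simp_all add: blanks_def)
  have ws: "length ws = Suc c"
    by (simp add: ws_def)
  have "reaches machine 1
      (Some Init, tape_at (bits_word x) 0 # blank_tape # replicate (Suc c) blank_tape @ blank_tape # blanks)
      (Some (Recode 0), tape_at (bits_word x) 0 # blank_tape # replicate (Suc c) (tape_end [1]) @ blank_tape # blanks)"
    using act_on_append[of 1 Rightwards "[]"] act_on_stay[of "tape_at (bits_word x) 0"]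
    by (intro machine_step) (simp_all add: blank_tape_eq)
  also have "reaches machine (length x) \<dots>
      (Some (Recode (length x mod period)), f # blank_tape # replicate (Suc c) (tape_end w) @ blank_tape # blanks)"
    using recode_run[of x "[]"] by (simp add: f_def w_def work_word_def)
  also have "reaches machine 1 \<dots>
      (Some RewindWork, f # blank_tape # replicate (Suc c) (tape_at w (int K - 1)) @ blank_tape # blanks)"
  proof -
    have "f 0 = 0" "tape_at w (int K) 0 = 0"
      using w by (simp_all add: f_def tape_at_read)
    then show ?thesis
      using w act_on_move[of w "int K" Leftwards] act_on_stay[of f]
      by (intro machine_step) simp_all
  qed
  also have "reaches machine (K + 1) \<dots>
      (Some Odometer, f # blank_tape # replicate (Suc c) (tape_at w 0) @ blank_tape # blanks)"
    using w by (intro rewind_work) auto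
  also have "reaches machine (K * odometer_time K c) \<dots>
      (Some Odometer, f # tally_tape e # ws @ input_tape e # blanks)"
    using odometer_run[OF w(1), of f blanks] w(2)
    by (simp add: blank_tape_eq tally_tape_def input_tape_def e_def expansion_def w_def ws_def)
  also have "reaches machine 1 \<dots> (Some RewindInput, f # g # ws @ tape_at W (int (length W) - 1) # blanks)"
    using odometer_exit[of f e w "tape_at w 0" blanks]
    by (simp add: g_def j_def W_def expanded_index_def expanded_input_def e_def ws_def)
  also have "reaches machine (length W + 1) \<dots> (Some (Run 0), f # g # ws @ tape_at W 0 # blanks)"
    using W by (intro rewind_input ws) auto
  finally have start: "reaches machine (1 + length x + 1 + (K + 1) + K * odometer_time K c + 1 + (length W + 1))
      (Some Init, tape_of (bits_word x) # replicate (2 + c + tapes N) blank_tape)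
      (Some (Run 0), f # g # ws @ tape_at W 0 # blanks)"
    by (simp add: tape_of_eq replicate_add blanks)
  obtain r ts' where r: "r \<le> T" "(tm_step N ^^ r) (0, tape_at W 0 # blanks) = (states N, ts')"
    "tape_shows (hd ts') (bits_word out)"
  proof -
    obtain r where "r \<le> T" "case (tm_step N ^^ r) (0, tape_at W 0 # blanks) of (q, ts) \<Rightarrow>
        q = states N \<and> tape_shows (hd ts) (bits_word out)"
      using halt by (auto simp: halts_with_def init_config_def W_def blanks_def tape_of_eq)
    then show thesis
      using that by (cases "(tm_step N ^^ r) (0, tape_at W 0 # blanks)") auto
  qed
  have "W ! k < 4" if "k < length W" for k
    using W(2) nth_mem[OF that] by auto
  then have "tape_at W 0 i < 4" for i
    by (simp add: tape_at_def tape_of_def nat_less_iff)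
  then have "tape_at W 0 i < symbols N" for i
    using N(2) less_le_trans by blast
  then have symbols: "\<forall>t \<in> set (tape_at W 0 # blanks). \<forall>i. t i < symbols N"
    using N(2) by (simp add: blanks_def blank_tape_def)
  have "length (tape_at W 0 # blanks) = tapes N"
    using N(1) by (simp add: blanks_def)
  from simulation_run[OF ws this symbols r(2), of f g] have sim:
    "reaches machine r (Some (Run 0), f # g # ws @ tape_at W 0 # blanks) (Some (Run (states N)), f # g # ws @ ts')"
    "length ts' = tapes N"
    by simp_all
  then obtain t ts where ts: "ts' = t # ts"
    using N(1) by (cases ts') auto
  have "f 1 = 0"
    by (simp add: f_def tape_at_def tape_of_def)
  then obtain ts'' where fin: "reaches machine (j + 1) (Some (Run (states N)), f # g # ws @ ts') (None, ts'')"
    "tape_shows (hd ts'') (bits_word [j < length out \<and> out ! j])"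
    using walk_run[OF ws, of t out f j ts] r(3) ts by (auto simp: g_def)
  note start
  also note sim(1)
  also note fin(1)
  finally have "reaches machine (4 + 2 * K + K * odometer_time K c + length W + 1 + T + j + 1)
      (Some Init, tape_of (bits_word x) # replicate (2 + c + tapes N) blank_tape) (None, ts'')"
    by (rule reaches_mono) (use r(1) in \<open>simp add: K_def\<close>)
  then show ?thesis
    using fin(2) by (auto simp: W_def j_def)
qed

section \<open>Polynomial running time of the expanding machine\<close>

lemma length_emission: "length (emission w u n) \<le> length w ^ n"
proof (induction n arbitrary: u)
  case 0
  then show ?case by (simp add: emitted_def Let_def)
next
  case (Suc n)
  have "length (emission w u (Suc n)) = (\<Sum>a\<leftarrow>w. length (emission w (u @ [a]) n))"
    by (simp add: length_concat comp_def)
  also have "\<dots> \<le> (\<Sum>a\<leftarrow>w. length w ^ n)"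
    by (intro sum_list_mono Suc)
  finally show ?case by (simp add: sum_list_triv)
qed

lemma set_emission: "set (emission w u n) \<subseteq> {..<4}"
  by (induction n arbitrary: u) (fastforce simp: emitted_def Let_def)+

text \<open>The argument is \<open>Suc x\<close> because the work word has a marker in front of the
  recoded input.\<close>

lemma odometer_time_poly: "\<exists>P :: nat poly. \<forall>x. poly P x = odometer_time (Suc x) n"
proof (induction n)
  case 0
  show ?case by (rule exI[of _ 1]) simp
next
  case (Suc n)
  then obtain P :: "nat poly" where "\<forall>x. poly P x = odometer_time (Suc x) n" by blast
  then show ?case
    by (intro exI[of _ "[:1, 1:] * P + [:3, 1:]"]) simp
qed

end

text \<open>As \<open>c\<close> is fixed, at most \<open>(length x + 1) ^ Suc c\<close> letters are
  emitted, and composing the time bound of \<open>N\<close> with this polynomial gives a polynomial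
  again.\<close>

theorem expander_class_P:
  assumes "wf_tm N"
    and F: "\<And>xs. halts_with N (tuple_word xs) (bits_word (F xs)) (poly p (length (tuple_word xs)))"
  shows "{x. \<exists>ys. tuple_word ys = expander.expanded_input c x \<and>
      expander.expanded_index c x < length (F ys) \<and> F ys ! expander.expanded_index c x} \<in> class_P"
    (is "?L \<in> class_P")
proof -
  interpret expander N c
    by unfold_locales fact
  obtain M where M: "wf_tm M"
    "\<And>w out T ts. reaches machine T
        (Some Init, tape_of w # replicate (2 + c + tapes N) blank_tape) (None, ts) \<Longrightarrow>
      tape_shows (hd ts) out \<Longrightarrow> halts_with M w out T"
    using machine_realizable by blast
  obtain Q where Q: "poly Q x = odometer_time (Suc x) c" for x
    using odometer_time_poly by blast
  define X :: "nat poly" where "X = [:1, 1:]"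
  \<comment> \<open>The 7 collects the single steps and the appended separator; the factor 2 covers
    the length of the expanded input and the index.\<close>
  define P where "P = 7 + 2 * X + X * Q + 2 * X ^ Suc c + pcompose p (X ^ Suc c + 1)"
  have "halts_with M (bits_word x) (bits_word [x \<in> ?L]) (poly P (length x))" for x
  proof -
    define K where "K = Suc (length x)"
    have len: "length (expansion x) \<le> K ^ Suc c"
      using length_emission[of "work_word x" "[]" "Suc c"] by (simp add: expansion_def work_word_def K_def)
    have small: "set (expansion x) \<subseteq> {..<4}"
      by (simp add: expansion_def set_emission del: emission.simps)
    have "set (filter (\<lambda>a. a \<noteq> 0) (expansion x)) \<subseteq> {1, 2, 3}"
      using small by fastforce
    then obtain ys where ys: "tuple_word ys = expanded_input x"
      using ex_tuple_word unfolding expanded_input_def by blast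
    have L: "x \<in> ?L \<longleftrightarrow> expanded_index x < length (F ys) \<and> F ys ! expanded_index x"
      unfolding mem_Collect_eq ys[symmetric] using tuple_word_inj by blast
    have "length (filter (\<lambda>a. a \<noteq> 0) (expansion x)) \<le> K ^ Suc c"
      using len order_trans[OF length_filter_le] by blast
    then have in_len: "length (expanded_input x) \<le> K ^ Suc c + 1"
      by (simp add: expanded_input_def)
    have idx: "expanded_index x \<le> K ^ Suc c"
      unfolding expanded_index_def using len order_trans[OF length_filter_le] by blast
    obtain ts where ts: "reaches machine
        (4 + 2 * K + K * odometer_time K c + length (expanded_input x) + 1 +
          poly p (length (expanded_input x)) + expanded_index x + 1)
        (Some Init, tape_of (bits_word x) # replicate (2 + c + tapes N) blank_tape) (None, ts)"
      "tape_shows (hd ts) (bits_word [x \<in> ?L])"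
      using machine_run[OF F[of ys, unfolded ys] small] unfolding L K_def by blast
    have "poly P (length x) = 7 + 2 * K + K * odometer_time K c + 2 * K ^ Suc c + poly p (K ^ Suc c + 1)"
      by (simp add: P_def X_def poly_pcompose Q K_def)
    then have "4 + 2 * K + K * odometer_time K c + length (expanded_input x) + 1 +
          poly p (length (expanded_input x)) + expanded_index x + 1 \<le> poly P (length x)"
      using in_len idx poly_nat_mono[OF in_len, of p] by linarith
    from reaches_mono[OF ts(1) this] ts(2) show ?thesis
      by (rule M(2))
  qed
  then show ?thesis
    using M(1) unfolding class_P_def by blast
qed

section \<open>Counting what commands emit, and layouts of commands\<close>

lemma concat_if_eq:
  "concat (map (\<lambda>b. if b = d then replicate n a else []) w) = replicate (count_list w d * n) a"
  by (induction w) (auto simp: replicate_add)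

lemma digit_sum: "(\<Sum>l<n. a div B ^ l mod B * B ^ l) = a mod B ^ n" for a B :: nat
proof (induction n)
  case (Suc n)
  have "a mod B ^ Suc n = B ^ n * (a div B ^ n mod B) + a mod B ^ n"
    using mod_mult2_eq[of a "B ^ n" B] by (simp add: mult.commute)
  then show ?case using Suc by (simp add: mult.commute)
qed simp

lemma concat_replicate_replicate: "concat (replicate n (replicate m a)) = replicate (n * m) a"
  by (induction n) (simp_all add: replicate_add)

lemma concat_map_replicate:
  "concat (map (\<lambda>l. replicate (f l) a) ls) = replicate (sum_list (map f ls)) a"
  by (induction ls) (simp_all add: replicate_add)

lemma concat_map_concat: "concat (map f (concat xss)) = concat (map (\<lambda>xs. concat (map f xs)) xss)"
  by (induction xss) simp_all

context expander
begin

text \<open>Each inner head contributes as a factor the number of cells with the letter that the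
  pattern \<open>P\<close> demands from it. A prefix \<open>us\<close> deviating from
  \<open>P\<close> blocks every emission.\<close>

lemma emission_command:
  assumes "l \<le> c" "a < 4" "length us + n = c"
  defines "P \<equiv> replicate l 3 @ replicate (c - l) 1"
  shows "emission w ((4 * Suc l + a) # us) n =
    (if us = take (length us) P
     then replicate (prod_list (map (count_list w) (drop (length us) P))) a else [])"
  using assms(3)
proof (induction n arbitrary: us)
  case 0
  have "(4 * Suc l + a) mod 4 = a"
    using assms(2) by (simp only: mod_mult_self4 mod_less)
  moreover have "(4 * Suc l + a) div 4 - 1 = l" "length P = c" "4 \<le> 4 * Suc l + a"
    using assms(1,2) by (auto simp: P_def)
  ultimately show ?case
    using 0 unfolding emission.simps emitted_def by (simp add: P_def del: mult_Suc_right)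
next
  case (Suc n)
  let ?i = "length us"
  have i: "?i < length P"
    using Suc.prems assms(1) by (simp add: P_def)
  have eq: "us @ [b] = take (Suc ?i) P \<longleftrightarrow> us = take ?i P \<and> b = P ! ?i" for b
    using i by (auto simp: take_Suc_conv_app_nth)
  have "emission w ((4 * Suc l + a) # us) (Suc n) =
      concat (map (\<lambda>b. if us = take ?i P \<and> b = P ! ?i
        then replicate (prod_list (map (count_list w) (drop (Suc ?i) P))) a else []) w)"
    using Suc.IH[of "us @ [_]"] Suc.prems by (simp add: eq cong: if_cong)
  also have "\<dots> = (if us = take ?i P
      then concat (map (\<lambda>b. if b = P ! ?i
        then replicate (prod_list (map (count_list w) (drop (Suc ?i) P))) a else []) w) else [])"
    by simp
  also have "\<dots> = (if us = take ?i P
     then replicate (prod_list (map (count_list w) (drop ?i P))) a else [])"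
    unfolding concat_if_eq Cons_nth_drop_Suc[OF i, symmetric] by simp
  finally show ?case .
qed

lemma emission_no_command:
  assumes "a < 4"
  shows "emission w (a # us) n = []"
  by (induction n arbitrary: us) (use assms in \<open>auto simp: emitted_def\<close>)

text \<open>Recoding depends on positions modulo the period, so a block of this length with at most
  one 1, at offset \<open>r\<close>, contributes the symbol \<open>3 + r\<close> or nothing of
  effect. The entries are polymorphic: the same layout serves for gates and for bits, and
  \<open>map_layout\<close> evaluates the former into the latter.\<close>

definition block :: "'a \<Rightarrow> nat \<times> 'a \<Rightarrow> 'a list" where
  "block z rv = replicate (fst rv) z @ snd rv # replicate (period - 1 - fst rv) z"

definition layout :: "'a \<Rightarrow> (nat \<times> 'a) list \<Rightarrow> 'a list" where
  "layout z rvs = concat (map (block z) rvs)"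

lemma map_layout: "map f (layout z rvs) = layout (f z) (map (apsnd f) rvs)"
  by (simp add: layout_def map_concat comp_def block_def)

lemma set_layout: "set (layout z rvs) \<subseteq> insert z (snd ` set rvs)"
  by (auto simp: layout_def block_def split: if_splits)

lemma length_layout: "\<forall>rv \<in> set rvs. fst rv < period \<Longrightarrow> length (layout z rvs) = period * length rvs"
  by (induction rvs) (auto simp: layout_def block_def)

lemma recode_zeros: "recode r (replicate n False) = replicate n 2"
  by (induction n arbitrary: r) simp_all

lemma recode_block:
  assumes "r < period"
  shows "recode 0 (block False (r, v)) =
    replicate r 2 @ (if v then 3 + r else 2) # replicate (period - 1 - r) 2"
  using assms by (simp add: block_def recode_append recode_zeros)

lemma recode_layout:
  assumes "\<forall>rv \<in> set rvs. fst rv < period"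
  shows "recode 0 (layout False rvs) =
    concat (map (\<lambda>(r, v). replicate r 2 @ (if v then 3 + r else 2) # replicate (period - 1 - r) 2) rvs)"
  using assms
proof (induction rvs)
  case (Cons rv rvs)
  obtain r v where rv: "rv = (r, v)" by (cases rv)
  have "length (block False rv) = period"
    using Cons.prems by (simp add: block_def)
  then show ?case
    using Cons recode_append[of 0 "block False rv" "layout False rvs"]
    by (simp add: layout_def rv recode_block)
qed (simp add: layout_def)

definition cell_output :: "nat \<Rightarrow> nat \<times> bool \<Rightarrow> nat list" where
  "cell_output B rv = (if snd rv \<and> 0 < fst rv then replicate (B ^ ((fst rv - 1) div 4)) ((fst rv - 1) mod 4) else [])"

definition command :: "nat \<Rightarrow> nat \<Rightarrow> nat" where
  "command l a = 1 + 4 * l + a"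

lemma command_less: "l \<le> c \<Longrightarrow> a < 4 \<Longrightarrow> command l a < period"
  by (simp add: command_def period_def)

lemma cell_output_command: "a < 4 \<Longrightarrow> cell_output B (command l a, v) = (if v then replicate (B ^ l) a else [])"
  by (simp add: cell_output_def command_def)

text \<open>The base \<open>B\<close> is supplied by the input itself, as the number of active cells
  at offset 0. Letters below 4 in front emit nothing, and an active command of level
  \<open>l\<close> sees \<open>B\<close> base letters and a single marker.\<close>

lemma expansion_layout:
  assumes rvs: "\<forall>rv \<in> set rvs. fst rv < period"
  defines "B \<equiv> length (filter (\<lambda>rv. fst rv = 0 \<and> snd rv) rvs)"
  shows "expansion (layout False rvs) = concat (map (cell_output B) rvs)"
proof -
  define w where "w = work_word (layout False rvs)"
  have "count_list (recode 0 (layout False rvs)) 3 = B"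
    unfolding recode_layout[OF rvs] B_def by (induction rvs) (auto simp: count_list_0_iff)
  then have c3: "count_list w 3 = B"
    by (simp add: w_def work_word_def)
  have "1 \<notin> set (recode r x)" for r x
    by (induction x arbitrary: r) auto
  then have c1: "count_list w 1 = 1"
    by (simp add: w_def work_word_def count_list_0_iff)
  have cmd: "(if v then emission w [3 + r] c else []) = cell_output B (r, v)" if "r < period" for r v
  proof (cases "r = 0")
    case True
    then show ?thesis by (simp add: cell_output_def emission_no_command)
  next
    case False
    define l a where "l = (r - 1) div 4" and "a = (r - 1) mod 4"
    have "r - 1 = 4 * l + a"
      by (simp add: l_def a_def)
    then have "3 + r = 4 * Suc l + a" using False by simp
    moreover have "l \<le> c" "a < 4"
      using that by (auto simp: l_def a_def period_def)
    ultimately have "emission w [3 + r] c = replicate (B ^ l) a"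
      using emission_command[of l a "[]" c w] c1 c3 by (simp add: add.assoc)
    then show ?thesis
      using False by (simp add: cell_output_def l_def a_def)
  qed
  have nop: "emission w [2] c = []" "emission w [1] c = []"
    by (simp_all add: emission_no_command)
  have "concat (map (\<lambda>a. emission w [a] c)
      (concat (map (\<lambda>(r, v). replicate r 2 @ (if v then 3 + r else 2) # replicate (period - 1 - r) 2) rvs))) =
      concat (map (cell_output B) rvs)"
    using rvs
  proof (induction rvs)
    case (Cons rv rvs)
    then show ?case
      using cmd[of "fst rv" "snd rv"] nop by (cases rv) (auto simp: concat_replicate_trivial)
  qed simp
  then show ?thesis
    using nop(2) unfolding expansion_def emission.simps w_def[symmetric]
    by (simp add: w_def work_word_def recode_layout[OF rvs])
qed

text \<open>Digit \<open>l\<close> of \<open>n\<close> in base \<open>B\<close> says how many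
  commands of level \<open>l\<close> are listed. A run of length \<open>n < B ^ Suc c\<close> thus
  takes at most \<open>Suc c * B\<close> cells.\<close>

definition repeat :: "nat \<Rightarrow> nat \<Rightarrow> nat \<Rightarrow> nat list" where
  "repeat B a n = concat (map (\<lambda>l. replicate (n div B ^ l mod B) (command l a)) [0..<Suc c])"

lemma set_repeat: "a < 4 \<Longrightarrow> set (repeat B a n) \<subseteq> {0<..<period}"
  using command_less by (auto simp: repeat_def command_def period_def split: if_splits)

lemma length_repeat: "0 < B \<Longrightarrow> length (repeat B a n) \<le> Suc c * B"
proof -
  assume "0 < B"
  have "length (repeat B a n) = (\<Sum>l\<leftarrow>[0..<Suc c]. n div B ^ l mod B)"
    by (simp add: repeat_def length_concat comp_def del: upt_Suc)
  also have "\<dots> \<le> (\<Sum>l\<leftarrow>[0..<Suc c]. B)"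
    using \<open>0 < B\<close> by (intro sum_list_mono) (simp add: less_imp_le)
  finally show ?thesis
    by (simp add: sum_list_triv del: upt_Suc)
qed

lemma cell_output_repeat:
  assumes "a < 4" "n < B ^ Suc c"
  shows "concat (map (\<lambda>r. cell_output B (r, True)) (repeat B a n)) = replicate n a"
proof -
  have "concat (map (\<lambda>r. cell_output B (r, True)) (repeat B a n)) =
      concat (map (\<lambda>l. replicate (n div B ^ l mod B * B ^ l) a) [0..<Suc c])"
    using assms(1)
    by (simp add: repeat_def concat_map_concat comp_def cell_output_command concat_replicate_replicate
        del: upt_Suc)
  also have "\<dots> = replicate (\<Sum>l<Suc c. n div B ^ l mod B * B ^ l) a"
    unfolding concat_map_replicate
    by (simp add: interv_sum_list_conv_sum_set_nat atLeast0LessThan del: upt_Suc)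
  also have "\<dots> = replicate n a"
    unfolding digit_sum using assms(2) by simp
  finally show ?thesis .
qed

end

section \<open>Hardwiring inputs of a circuit\<close>

definition wire :: "gate list \<Rightarrow> gate \<Rightarrow> gate" where
  "wire gs g = (case g of Inp i \<Rightarrow> gs ! i | _ \<Rightarrow> g)"

lemma wire_simps [simp]:
  "wire gs (Inp i) = gs ! i" "wire gs (Const b) = Const b" "wire gs (Neg i) = Neg i"
  "wire gs (And i j) = And i j" "wire gs (Or i j) = Or i j"
  by (simp_all add: wire_def)

text \<open>Every input gate is replaced in place by a single input or constant gate, so addresses
  and size are unchanged. Such gates do not look at earlier values, whence
  \<open>gate_val y []\<close>.\<close>

lemma hardwire:
  assumes C: "wf_circuit (length gs) C" and gs: "set gs \<subseteq> Inp ` {..<k} \<union> range Const"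
  shows "wf_circuit k (map (wire gs) C)"
    and "circuit_eval (map (wire gs) C) y = circuit_eval C (map (gate_val y []) gs)"
proof -
  have leaf: "gs ! i \<in> Inp ` {..<k} \<union> range Const" if "i < length gs" for i
    using gs nth_mem[OF that] by blast
  have "wf_gate k p (wire gs g)" if "wf_gate (length gs) p g" for p g
    using that leaf by (cases g) force+
  then show "wf_circuit k (map (wire gs) C)"
    using C by (simp add: wf_circuit_def)
  have inp: "gate_val y v (wire gs g) = gate_val (map (gate_val y []) gs) v g" if "g \<in> set C" for v g
  proof -
    have "\<exists>p. wf_gate (length gs) p g"
      using that C by (metis in_set_conv_nth wf_circuit_def)
    then show ?thesis
      using leaf by (cases g) force+
  qed
  have "foldl (\<lambda>v g. v @ [gate_val y v g]) [] (map (wire gs) C) =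
      foldl (\<lambda>v g. v @ [gate_val (map (gate_val y []) gs) v g]) [] C"
    unfolding foldl_map using inp by (intro foldl_cong) auto
  then show "circuit_eval (map (wire gs) C) y = circuit_eval C (map (gate_val y []) gs)"
    by (simp add: circuit_eval_def)
qed

lemma sum_bits: "(\<Sum>i<k. of_bool (bit j i) * 2 ^ i) = (take_bit k j :: nat)"
  by (induction k) (simp_all add: take_bit_Suc_from_most)

context expander
begin

text \<open>
  The layout of a tuple \<open>(1\<^sup>m, x\<^sub>1, \<dots>, x\<^sub>r)\<close>, where \<open>(u, a)\<close> stands for the string \<open>u\<close> padded with
  \<open>a\<close> zeros, and of an index whose \<open>k\<close> bits are left open: bit \<open>i\<close> switches \<open>2 ^ (i mod h)\<close> commands
  on, each of which contributes \<open>(2 ^ h) ^ (i div h)\<close> to the tally.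
\<close>

definition tuple_cells :: "nat \<Rightarrow> nat \<Rightarrow> (bool list \<times> nat) list \<Rightarrow> nat list" where
  "tuple_cells B m us = repeat B 2 m @
     concat (map (\<lambda>(u, a). command 0 3 # map (\<lambda>b. command 0 (if b then 2 else 1)) u @ repeat B 1 a) us)"

definition cells :: "nat \<Rightarrow> nat \<Rightarrow> (bool list \<times> nat) list \<Rightarrow> (nat \<times> gate) list" where
  "cells h k us =
     map (\<lambda>r. (r, Const True)) (replicate (2 ^ h) 0 @ tuple_cells (2 ^ h) (2 ^ k) us) @
     concat (map (\<lambda>i. replicate (2 ^ (i mod h)) (command (i div h) 0, Inp i)) [0..<k])"

abbreviation padded :: "bool list \<times> nat \<Rightarrow> bool list" where
  "padded ua \<equiv> fst ua @ replicate (snd ua) False"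

lemma set_tuple_cells: "set (tuple_cells B m us) \<subseteq> {0<..<period}"
proof -
  have "0 < r \<and> r < period" if "r \<in> set (repeat B a n)" "a < 4" for r a n
    using set_repeat[OF that(2)] that(1) by fastforce
  moreover have "0 < command 0 a" for a
    by (simp add: command_def)
  ultimately show ?thesis
    by (auto simp: tuple_cells_def command_less)
qed

lemma cells_bound:
  assumes "k \<le> h * Suc c"
  shows "\<forall>rg \<in> set (cells h k us). fst rg < period"
proof -
  have "i div h < Suc c" if "i < k" for i
    using assms that by (intro less_mult_imp_div_less) (simp add: mult.commute)
  then show ?thesis
    using set_tuple_cells by (fastforce simp: cells_def intro: command_less)
qed

lemma set_layout_cells: "set (layout (Const False) (cells h k us)) \<subseteq> Inp ` {..<k} \<union> range Const"
proof -
  have "snd ` set (cells h k us) \<subseteq> Inp ` {..<k} \<union> range Const"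
    by (auto simp: cells_def)
  then show ?thesis
    by (intro subset_trans[OF set_layout]) (simp add: rangeI)
qed

text \<open>The cells emit a separator before each string of \<open>us\<close> and none at the end;
  the final \<open>[3]\<close> is the one appended by the machine.\<close>

lemma output_tuple_cells:
  assumes "m < B ^ Suc c" "\<forall>ua \<in> set us. snd ua < B ^ Suc c"
  shows "concat (map (\<lambda>r. cell_output B (r, True)) (tuple_cells B m us)) @ [3] =
    tuple_word (replicate m True # map padded us)"
proof -
  have lit: "concat (map (\<lambda>r. cell_output B (r, True)) (map (\<lambda>b. command 0 (if b then 2 else 1)) u)) = bits_word u" for u
    by (induction u) (simp_all add: cell_output_command bits_word_def)
  have "concat (map (\<lambda>r. cell_output B (r, True))
      (concat (map (\<lambda>(u, a). command 0 3 # map (\<lambda>b. command 0 (if b then 2 else 1)) u @ repeat B 1 a) us))) @ [3] =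
      3 # tuple_word (map padded us)"
    using assms(2)
  proof (induction us)
    case (Cons ua us)
    then show ?case
      using lit[of "fst ua"]
      by (cases ua) (simp add: cell_output_command cell_output_repeat tuple_word_def bits_word_def)
  qed (simp add: tuple_word_def)
  then show ?thesis
    using assms(1) by (simp add: tuple_cells_def cell_output_repeat tuple_word_def bits_word_def)
qed

lemma output_index:
  assumes "length y = k"
  shows "concat (map (cell_output (2 ^ h)) (concat (map (\<lambda>i. replicate (2 ^ (i mod h)) (command (i div h) 0, y ! i)) [0..<k]))) =
    replicate (\<Sum>i<k. of_bool (y ! i) * 2 ^ i) 0"
proof -
  have "(2 ^ (i mod h) * (2 ^ h) ^ (i div h) :: nat) = 2 ^ i" for i
    by (simp flip: power_mult power_add)
  then have "concat (map (cell_output (2 ^ h)) (replicate (2 ^ (i mod h)) (command (i div h) 0, y ! i))) =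
      replicate (of_bool (y ! i) * 2 ^ i) 0" for i
    by (simp add: cell_output_command concat_replicate_replicate)
  then have "concat (map (cell_output (2 ^ h)) (concat (map (\<lambda>i. replicate (2 ^ (i mod h)) (command (i div h) 0, y ! i)) [0..<k]))) =
      concat (map (\<lambda>i. replicate (of_bool (y ! i) * 2 ^ i) 0) [0..<k])"
    by (simp add: concat_map_concat comp_def)
  then show ?thesis
    unfolding concat_map_replicate by (simp add: interv_sum_list_conv_sum_set_nat atLeast0LessThan)
qed

text \<open>From \<open>k < h * Suc c\<close> follow \<open>2 ^ k < (2 ^ h) ^ Suc c\<close>, so all
  run lengths have enough digits, and \<open>i div h \<le> c\<close> for \<open>i < k\<close>, so
  all index commands exist.\<close>

lemma expansion_cells:
  assumes k: "k < h * Suc c" and us: "\<forall>ua \<in> set us. snd ua < 2 ^ k" and y: "length y = k"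
  defines "x \<equiv> map (gate_val y []) (layout (Const False) (cells h k us))"
  shows "expanded_input x = tuple_word (replicate (2 ^ k) True # map padded us)"
    and "expanded_index x = (\<Sum>i<k. of_bool (y ! i) * 2 ^ i)"
proof -
  define B :: nat where "B = 2 ^ h"
  define ix where "ix = concat (map (\<lambda>i. replicate (2 ^ (i mod h)) (command (i div h) 0, y ! i)) [0..<k])"
  define tc where "tc = tuple_cells B (2 ^ k) us"
  define rvs where "rvs = map (\<lambda>r. (r, True)) (replicate B 0 @ tc) @ ix"
  have rvs: "map (apsnd (gate_val y [])) (cells h k us) = rvs"
    by (simp add: rvs_def tc_def ix_def cells_def B_def map_concat comp_def)
  have x: "x = layout False rvs"
    by (simp add: x_def map_layout rvs)
  have bound: "\<forall>rv \<in> set rvs. fst rv < period"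
    using cells_bound[of k h us] k by (simp flip: rvs)
  have tc0: "0 < r" if "r \<in> set tc" for r
    using that set_tuple_cells by (force simp: tc_def)
  have ix0: "fst rv \<noteq> 0" if "rv \<in> set ix" for rv
    using that by (auto simp: ix_def command_def split: if_splits)
  have "filter (\<lambda>rv. fst rv = 0 \<and> snd rv) rvs = replicate B (0, True)"
    using tc0 ix0 by (auto simp: rvs_def filter_empty_conv filter_map comp_def)
  then have "length (filter (\<lambda>rv. fst rv = 0 \<and> snd rv) rvs) = B"
    by simp
  from expansion_layout[OF bound, unfolded this] have ex: "expansion x = concat (map (cell_output B) rvs)"
    by (simp add: x)
  have big: "(2::nat) ^ k < B ^ Suc c"
    using k by (simp add: B_def del: power_Suc flip: power_mult)
  define out where "out = concat (map (\<lambda>r. cell_output B (r, True)) tc)"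
  have out: "out @ [3] = tuple_word (replicate (2 ^ k) True # map padded us)"
    using output_tuple_cells[OF big, of us] us big by (auto simp: out_def tc_def intro: less_trans)
  have "concat (map (cell_output B) rvs) = out @ replicate (\<Sum>i<k. of_bool (y ! i) * 2 ^ i) 0"
    using output_index[OF y, of h]
    by (simp add: rvs_def out_def comp_def ix_def B_def cell_output_def concat_replicate_trivial)
  moreover have "\<forall>a \<in> set out. 0 < a"
  proof -
    have "0 \<notin> set (tuple_word xs)" for xs
      by (auto simp: tuple_word_def bits_word_def)
    then have "0 \<notin> set (out @ [3])"
      by (simp only: out not_False_eq_True)
    then show ?thesis by (auto intro: gr0I)
  qed
  ultimately have "filter (\<lambda>a. a \<noteq> 0) (expansion x) = out"
    "filter (\<lambda>a. a = 0) (expansion x) = replicate (\<Sum>i<k. of_bool (y ! i) * 2 ^ i) 0"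
    unfolding ex by (auto simp: filter_id_conv filter_empty_conv)
  then show "expanded_input x = tuple_word (replicate (2 ^ k) True # map padded us)"
    "expanded_index x = (\<Sum>i<k. of_bool (y ! i) * 2 ^ i)"
    using out by (simp_all add: expanded_input_def expanded_index_def)
qed

lemma length_cells:
  assumes "0 < h" "\<forall>ua \<in> set us. length (fst ua) \<le> u"
  shows "length (cells h k us) \<le>
    2 ^ h + Suc c * 2 ^ h + length us * (Suc u + Suc c * 2 ^ h) + k * 2 ^ h"
proof -
  define B :: nat where "B = 2 ^ h"
  have "length (concat (map (\<lambda>(v, a). command 0 3 # map (\<lambda>b. command 0 (if b then 2 else 1)) v @ repeat B 1 a) us))
      \<le> length us * (Suc u + Suc c * B)"
    using assms(2)
  proof (induction us)
    case (Cons ua us)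
    then show ?case
      using length_repeat[of B 1 "snd ua"] by (cases ua) (auto simp: B_def)
  qed simp
  moreover have "(\<Sum>i\<leftarrow>[0..<k]. 2 ^ (i mod h)) \<le> (\<Sum>i\<leftarrow>[0..<k]. B)"
    unfolding B_def using assms(1) by (intro sum_list_mono power_increasing) auto
  moreover have "length (repeat B 2 (2 ^ k)) \<le> Suc c * B"
    by (rule length_repeat) (simp add: B_def)
  ultimately show ?thesis
    unfolding cells_def tuple_cells_def B_def[symmetric]
    by (simp add: length_concat comp_def sum_list_triv)
qed

end

text \<open>The layout \<open>G\<close> has one length for all indices \<open>j\<close>, so a single
  circuit of the family serves them all. Hardwiring leaves the \<open>k\<close> bits of
  \<open>j\<close> as its inputs.\<close>

lemma round_circuit:
  fixes c h k :: nat and us :: "(bool list \<times> nat) list"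
  assumes "wf_tm N"
  defines "G \<equiv> expander.layout c (Const False) (expander.cells c h k us)"
  assumes L: "decided_by {x. \<exists>ys. tuple_word ys = expander.expanded_input c x \<and>
      expander.expanded_index c x < length (F ys) \<and> F ys ! expander.expanded_index c x} C"
    and k: "k < h * Suc c" and us: "\<forall>ua \<in> set us. snd ua < 2 ^ k"
    and len: "length (F (replicate (2 ^ k) True # map (\<lambda>ua. fst ua @ replicate (snd ua) False) us)) = 2 ^ k"
  shows "wf_circuit k (map (wire G) (C (length G)))"
    and "truth_table k (map (wire G) (C (length G))) =
      F (replicate (2 ^ k) True # map (\<lambda>ua. fst ua @ replicate (snd ua) False) us)"
proof -
  interpret expander N c
    by unfold_locales fact
  have wf: "wf_circuit (length G) (C (length G))"
    using L by (simp add: decided_by_def)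
  have G: "set G \<subseteq> Inp ` {..<k} \<union> range Const"
    unfolding G_def by (rule set_layout_cells)
  show "wf_circuit k (map (wire G) (C (length G)))"
    by (rule hardwire[OF wf G])
  let ?F = "F (replicate (2 ^ k) True # map (\<lambda>ua. fst ua @ replicate (snd ua) False) us)"
  have "circuit_eval (map (wire G) (C (length G))) (nat_bits k j) = ?F ! j" if j: "j < 2 ^ k" for j
  proof -
    define x where "x = map (gate_val (nat_bits k j) []) G"
    have "(\<Sum>i<k. of_bool (nat_bits k j ! i) * 2 ^ i) = (\<Sum>i<k. of_bool (bit j i) * 2 ^ i :: nat)"
      by (intro sum.cong) (auto simp: nat_bits_def)
    also have "\<dots> = j"
      using j by (simp add: sum_bits take_bit_nat_eq_self)
    finally have "expanded_index x = j"
      using expansion_cells(2)[OF k us, of "nat_bits k j"] by (simp add: x_def G_def)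
    moreover have "expanded_input x = tuple_word (replicate (2 ^ k) True # map padded us)"
      using expansion_cells(1)[OF k us, of "nat_bits k j"] by (simp add: x_def G_def)
    moreover have "circuit_eval (C (length x)) x \<longleftrightarrow> (\<exists>ys. tuple_word ys = expanded_input x \<and>
        expanded_index x < length (F ys) \<and> F ys ! expanded_index x)"
      using L unfolding decided_by_def by blast
    ultimately have "circuit_eval (C (length x)) x \<longleftrightarrow> ?F ! j"
      using len j tuple_word_inj by metis
    then show ?thesis
      using hardwire(2)[OF wf G, of "nat_bits k j"] by (simp add: x_def)
  qed
  then show "truth_table k (map (wire G) (C (length G))) = ?F"
    by (intro nth_equalityI) (simp_all add: truth_table_def len)
qed

section \<open>Defeating the Student\<close>

lemma tt_circuit_code:
  assumes "wf_circuit k D" "length D \<le> s"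
  shows "tt s k (circuit_code s k D) = truth_table k D"
proof -
  have "codes s k (circuit_code s k D) D"
    using assms by (simp add: codes_def)
  moreover from this have "(THE C. codes s k (circuit_code s k D) C) = D"
    using codes_unique by blast
  ultimately show ?thesis
    unfolding tt_def by auto
qed

lemma addr_width_le:
  assumes "1 \<le> s" "s \<le> 2 ^ k"
  shows "addr_width s k \<le> k"
proof -
  have "max s k \<le> 2 ^ k"
    using assms(2) less_exp[of k] by simp
  then have "real (max s k) \<le> 2 powr real k"
    by (simp add: powr_realpow)
  then have "log 2 (real (max s k)) \<le> real k"
    using assms(1) by (subst log_le_iff) auto
  then show ?thesis
    by (simp add: addr_width_def ceiling_le_iff)
qed

text \<open>In round \<open>i\<close> (counted from 0) the earlier unpadded codes have length at
  most \<open>B ^ e\<close> with \<open>e = exponent d i\<close>. The layout then has length at most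
  \<open>B ^ (e + 3)\<close>, the circuit has at most \<open>B ^ ((e + 3) * d + 1)\<close> gates,
  and each gate takes at most \<open>B ^ 2\<close> bits.\<close>

fun exponent :: "nat \<Rightarrow> nat \<Rightarrow> nat" where
  "exponent d 0 = 2"
| "exponent d (Suc i) = (exponent d i + 3) * d + 3"

lemma exponent_mono:
  assumes "1 \<le> d" "i \<le> j"
  shows "exponent d i \<le> exponent d j"
proof -
  have "exponent d i \<le> exponent d (Suc i)" for i
  proof -
    have "exponent d i \<le> (exponent d i + 3) * 1"
      by simp
    also have "\<dots> \<le> (exponent d i + 3) * d"
      using assms(1) by (intro mult_le_mono2)
    finally show ?thesis
      by simp
  qed
  then show ?thesis
    using assms(2) by (rule lift_Suc_mono_le)
qed

text \<open>The sum in parentheses is at most \<open>6 * B ^ (e + 1)\<close>; the 6 and the period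
  \<open>P\<close> each cost one more factor \<open>B\<close>.\<close>

lemma round_size:
  fixes B :: nat
  assumes B: "7 \<le> B" "r \<le> B" "P \<le> B" "c \<le> B" "k \<le> B" and "2 \<le> e" and u: "u \<le> B ^ e"
    and n: "n \<le> P * (B + c * B + r * (Suc u + c * B) + k * B)"
  shows "n \<le> B ^ (e + 3)"
proof -
  have pow: "B ^ i \<le> B ^ (e + 1)" if "i \<le> e + 1" for i
    using B(1) that by (intro power_increasing) auto
  have sq: "x * B \<le> B ^ (e + 1)" if "x \<le> B" for x
    using order_trans[OF mult_le_mono1[OF that, of B] pow[of 2, unfolded power2_eq_square]] assms(6)
    by simp
  have low: "B \<le> B ^ (e + 1)" "B ^ 3 \<le> B ^ (e + 1)"
    using pow[of 1] pow[of 3] assms(6) by simp_all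
  have "r * (Suc u + c * B) \<le> B * (1 + B ^ e + B * B)"
    using B u by (intro mult_le_mono add_mono) auto
  also have "\<dots> = B + B ^ (e + 1) + B ^ 3"
    by (simp add: algebra_simps eval_nat_numeral)
  also have "\<dots> \<le> 3 * B ^ (e + 1)"
    using low by linarith
  finally have "B + c * B + r * (Suc u + c * B) + k * B \<le> 6 * B ^ (e + 1)"
    using sq[OF B(4)] sq[OF B(5)] low(1) by linarith
  also have "\<dots> \<le> B * B ^ (e + 1)"
    using B(1) by (intro mult_le_mono1) simp
  finally have "P * (B + c * B + r * (Suc u + c * B) + k * B) \<le> B * (B * B ^ (e + 1))"
    by (intro mult_le_mono B(3))
  with n show ?thesis
    by (simp add: eval_nat_numeral mult.assoc)
qed

text \<open>Induction on rounds, with each answer kept as a pair of an unpadded code and a number of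
  zeros. Only the former enters the size estimates, while the latter is compressed by
  \<open>repeat\<close>.\<close>

lemma teacher_strategy:
  fixes c h k s t :: nat
  defines "B \<equiv> 2 ^ h" and "n \<equiv> code_len s"
  assumes N: "wf_tm N" and d: "1 \<le> d"
    and L: "decided_by {x. \<exists>ys. tuple_word ys = expander.expanded_input c x \<and>
      expander.expanded_index c x < length (F ys) \<and> F ys ! expander.expanded_index c x} C"
    and C: "\<And>l. n0 \<le> l \<Longrightarrow> length (C l) \<le> A * l ^ d"
    and k: "k < h * Suc c"
    and B: "7 \<le> B" "t \<le> B" "4 * c + 5 \<le> B" "A \<le> B" "n0 \<le> B" "k \<le> B"
    and s: "B ^ exponent d t \<le> s" "s \<le> 2 ^ k" and n: "n < 2 ^ k"
    and F: "\<And>xs. length xs < t \<Longrightarrow> \<forall>x \<in> set xs. length x = n \<Longrightarrow> length (F (replicate (2 ^ k) True # xs)) = 2 ^ k"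
  shows "\<exists>xs. length xs = t \<and> (\<forall>x \<in> set xs. length x = n) \<and>
    (\<forall>i<t. tt s k (xs ! i) = F (replicate (2 ^ k) True # take i xs))"
proof -
  interpret expander N c
    by unfold_locales fact
  have h: "0 < h"
    using k by (cases h) auto
  have "B ^ 1 \<le> B ^ exponent d t"
    using exponent_mono[OF d, of 0 t] B(1) by (intro power_increasing) auto
  then have "B \<le> s"
    using s(1) by simp
  then have s_ge: "2 \<le> s" "k \<le> s"
    using B by auto
  have "\<exists>us. length us = i \<and>
      (\<forall>ua \<in> set us. length (fst ua) \<le> B ^ exponent d i \<and> length (fst ua) + snd ua = n) \<and>
      (\<forall>r<i. tt s k (padded (us ! r)) = F (replicate (2 ^ k) True # map padded (take r us)))"
    if "i \<le> t" for i
    using that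
  proof (induction i)
    case 0
    then show ?case by simp
  next
    case (Suc i)
    then obtain us where us: "length us = i"
      "\<forall>ua \<in> set us. length (fst ua) \<le> B ^ exponent d i \<and> length (fst ua) + snd ua = n"
      "\<forall>r<i. tt s k (padded (us ! r)) = F (replicate (2 ^ k) True # map padded (take r us))"
      by auto
    define e where "e = exponent d i"
    define G where "G = layout (Const False) (cells h k us)"
    define D where "D = map (wire G) (C (length G))"
    define u where "u = gates_code (addr_width s k) D"
    define a where "a = n - length u"
    have e: "2 \<le> e"
      using exponent_mono[OF d, of 0 i] by (simp add: e_def)
    have small: "\<forall>ua \<in> set us. snd ua < 2 ^ k"
      using us(2) n by auto
    have out_len: "length (F (replicate (2 ^ k) True # map padded us)) = 2 ^ k"
      using us Suc.prems by (intro F) auto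
    have D: "wf_circuit k D" "truth_table k D = F (replicate (2 ^ k) True # map padded us)"
      using round_circuit[OF N L k small out_len] by (simp_all add: D_def G_def)
    have G_len: "length G = period * length (cells h k us)"
      unfolding G_def using k by (intro length_layout cells_bound) simp
    have "length (cells h k us) \<le> B + Suc c * B + length us * (Suc (B ^ e) + Suc c * B) + k * B"
      unfolding B_def e_def by (rule length_cells[OF h]) (use us(2) in \<open>simp add: B_def\<close>)
    then have "length G \<le> period * (B + Suc c * B + length us * (Suc (B ^ e) + Suc c * B) + k * B)"
      unfolding G_len by (rule mult_le_mono2)
    then have G_up: "length G \<le> B ^ (e + 3)"
      using B e us(1) Suc.prems by (intro round_size[where P = period and c = "Suc c"]) (auto simp: period_def)
    \<comment> \<open>The \<open>B\<close> base cells alone make the layout long enough for the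
      asymptotic size bound, which holds from \<open>n0\<close> on.\<close>
    have "B \<le> length (cells h k us)"
      by (simp add: cells_def B_def)
    also have "\<dots> \<le> length G"
      by (simp add: G_len period_def)
    finally have "n0 \<le> length G"
      using B(5) by simp
    then have "length D \<le> A * length G ^ d"
      using C by (simp add: D_def)
    also have "\<dots> \<le> B * (B ^ (e + 3)) ^ d"
      by (intro mult_le_mono power_mono B G_up) simp
    also have "\<dots> = B ^ ((e + 3) * d + 1)"
      by (simp add: power_mult)
    finally have D_len: "length D \<le> B ^ ((e + 3) * d + 1)" .
    have "B ^ ((e + 3) * d + 1) \<le> B ^ exponent d (Suc i)"
      using B(1) by (intro power_increasing) (auto simp: e_def)
    also have "\<dots> \<le> B ^ exponent d t"
      using B(1) exponent_mono[OF d Suc.prems] by (intro power_increasing) auto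
    finally have D_s: "length D \<le> s"
      using D_len s(1) by simp
    have code: "circuit_code s k D = padded (u, a)"
      by (simp add: circuit_code_def u_def a_def n_def Let_def)
    then have ua: "length u + a = n"
      using length_circuit_code[OF s_ge D_s] by (simp add: n_def)
    \<comment> \<open>The number of bits per gate; its bound \<open>B ^ 2\<close> accounts for 2 of
      the final 3 in \<open>exponent\<close>.\<close>
    have "3 + 2 * addr_width s k \<le> 3 + 2 * B"
      using addr_width_le[of s k] s_ge s(2) B by simp
    also have "\<dots> \<le> 7 * B"
      using B(1) by simp
    also have "\<dots> \<le> B ^ 2"
      using B(1) by (simp add: power2_eq_square)
    finally have "length u \<le> B ^ ((e + 3) * d + 1) * B ^ 2"
      unfolding u_def length_gates_code by (intro mult_le_mono D_len)
    also have "\<dots> = B ^ exponent d (Suc i)"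
    proof -
      have "(e + 3) * d + 1 + 2 = exponent d (Suc i)"
        by (simp add: e_def)
      then show ?thesis
        by (simp only: power_add[symmetric])
    qed
    finally have u_len: "length u \<le> B ^ exponent d (Suc i)" .
    have "B ^ exponent d i \<le> B ^ exponent d (Suc i)"
      using B(1) exponent_mono[OF d, of i "Suc i"] by (intro power_increasing) auto
    then have "\<forall>ua \<in> set us. length (fst ua) \<le> B ^ exponent d (Suc i)"
      using us(2) order_trans by blast
    moreover have "tt s k (padded (u, a)) = F (replicate (2 ^ k) True # map padded us)"
      using tt_circuit_code[OF D(1) D_s] D(2) by (simp add: code)
    ultimately show ?case
      using us u_len ua
      by (intro exI[of _ "us @ [(u, a)]"]) (auto simp: nth_append less_Suc_eq simp del: exponent.simps)
  qed
  from this[OF order_refl] obtain us where us: "length us = t"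
    "\<forall>ua \<in> set us. length (fst ua) + snd ua = n"
    "\<forall>r<t. tt s k (padded (us ! r)) = F (replicate (2 ^ k) True # map padded (take r us))"
    by blast
  then show ?thesis
    by (intro exI[of _ "map padded us"]) (auto simp: take_map)
qed

section \<open>Asymptotic estimates and the choice of parameters\<close>

lemma size_bound_le:
  assumes "\<epsilon> < 1"
  shows "size_bound \<epsilon> k \<le> 2 ^ k"
proof -
  have "2 powr (\<epsilon> * real k) \<le> 2 powr real k"
    using assms mult_right_mono[of \<epsilon> 1 "real k"] by (intro powr_mono) auto
  then have "2 powr (\<epsilon> * real k) \<le> of_int (2 ^ k)"
    by (simp add: powr_realpow)
  then have "\<lceil>2 powr (\<epsilon> * real k)\<rceil> \<le> 2 ^ k"
    by (subst ceiling_le_iff)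
  then show ?thesis
    by (simp add: size_bound_def nat_le_iff)
qed

text \<open>Because \<open>log 2 s \<le> k\<close>, the code length is at most
  \<open>10 * (2 powr (\<epsilon> * k) + 1) * k + 1\<close>, where the two summands 1 come from
  rounding up.\<close>

lemma eventually_code_len_less:
  assumes "0 < \<epsilon>" "\<epsilon> < 1"
  shows "eventually (\<lambda>k. code_len (size_bound \<epsilon> k) < 2 ^ k) sequentially"
proof -
  have "eventually (\<lambda>k::nat. 10 * (2 powr (\<epsilon> * real k) + 1) * real k + 1 < 2 powr real k) sequentially"
    using assms by real_asymp
  then show ?thesis
  proof eventually_elim
    case (elim k)
    define s where "s = size_bound \<epsilon> k"
    have "1 \<le> s"
      unfolding s_def size_bound_def by (simp add: Suc_le_eq)
    have "real s \<le> 2 powr (\<epsilon> * real k) + 1"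
      unfolding s_def size_bound_def by (simp add: less_imp_le)
    moreover have "log 2 (real s) \<le> real k"
    proof -
      have "real s \<le> real (2 ^ k)"
        using size_bound_le[OF assms(2), of k] unfolding s_def of_nat_le_iff .
      then show ?thesis
        using \<open>1 \<le> s\<close> by (subst log_le_iff) (auto simp: powr_realpow)
    qed
    ultimately have "10 * real s * log 2 (real s) \<le> 10 * (2 powr (\<epsilon> * real k) + 1) * real k"
      using \<open>1 \<le> s\<close> by (intro mult_mono) auto
    with elim have "10 * real s * log 2 (real s) + 1 < 2 powr real k"
      by simp
    moreover have "0 \<le> 10 * real s * log 2 (real s)"
      using \<open>1 \<le> s\<close> by simp
    ultimately have "real (code_len s) < 2 powr real k"
      unfolding code_len_def by (simp add: of_nat_nat) linarith
    then have "real (code_len s) < real (2 ^ k)"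
      by (simp add: powr_realpow)
    then show ?case
      unfolding s_def of_nat_less_iff .
  qed
qed

text \<open>For \<open>h = k div q\<close>, the number \<open>k\<close> is below the linear
  expression \<open>q * (h + 1)\<close>, which \<open>2 ^ h\<close> eventually exceeds.\<close>

lemma eventually_power_div:
  fixes b q :: nat
  assumes "0 < q"
  shows "eventually (\<lambda>k. b \<le> 2 ^ (k div q) \<and> k \<le> 2 ^ (k div q)) sequentially"
proof -
  have "eventually (\<lambda>h::nat. real b \<le> 2 ^ h \<and> real q * (real h + 1) \<le> 2 ^ h) sequentially"
    using assms by (intro eventually_conj) real_asymp+
  moreover have "filterlim (\<lambda>k. k div q) sequentially sequentially"
    using assms by (rule filterlim_at_top_div_const_nat)
  ultimately have "eventually (\<lambda>k. real b \<le> 2 ^ (k div q) \<and> real q * (real (k div q) + 1) \<le> 2 ^ (k div q)) sequentially"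
    unfolding filterlim_iff by blast
  then show ?thesis
  proof eventually_elim
    case (elim k)
    have "k \<le> q * (k div q + 1)"
      using dividend_less_times_div[OF assms, of k] by simp
    then have "real k \<le> real (q * (k div q + 1))"
      by (simp only: of_nat_le_iff)
    also have "\<dots> = real q * (real (k div q) + 1)"
      by (simp add: algebra_simps)
    finally have "real k \<le> real (2 ^ (k div q))" "real b \<le> real (2 ^ (k div q))"
      unfolding of_nat_power of_nat_numeral using elim by linarith+
    then show ?case
      by (simp only: of_nat_le_iff)
  qed
qed

theorem theorem5p7:
  fixes \<epsilon> :: real
  assumes "hypothesis_H" and "0 < \<epsilon>" and "\<epsilon> < 1"
  shows "\<not> (\<exists>(t::nat) (S :: bool list list \<Rightarrow> bool list).
    1 \<le> t \<and> polytime_computable S \<and>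
    (\<forall>k\<ge>1. let s = size_bound \<epsilon> k; m = 2 ^ k; n = code_len s in
       n < m \<longrightarrow>
       (\<forall>xs :: bool list list. length xs = t \<and> (\<forall>x \<in> set xs. length x = n) \<longrightarrow>
          (\<forall>i<t. length (S (replicate m True # take i xs)) = m) \<and>
          (\<exists>i<t. tt s k (xs ! i) \<noteq> S (replicate m True # take i xs)))))"
proof
  assume "\<exists>(t::nat) (S :: bool list list \<Rightarrow> bool list).
    1 \<le> t \<and> polytime_computable S \<and>
    (\<forall>k\<ge>1. let s = size_bound \<epsilon> k; m = 2 ^ k; n = code_len s in
       n < m \<longrightarrow>
       (\<forall>xs :: bool list list. length xs = t \<and> (\<forall>x \<in> set xs. length x = n) \<longrightarrow>
          (\<forall>i<t. length (S (replicate m True # take i xs)) = m) \<and>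
          (\<exists>i<t. tt s k (xs ! i) \<noteq> S (replicate m True # take i xs))))"
  then obtain t S where t: "1 \<le> t" and S: "polytime_computable S"
    and witness: "\<And>k xs. 1 \<le> k \<Longrightarrow> code_len (size_bound \<epsilon> k) < 2 ^ k \<Longrightarrow> length xs = t \<Longrightarrow>
      \<forall>x \<in> set xs. length x = code_len (size_bound \<epsilon> k) \<Longrightarrow>
      (\<forall>i<t. length (S (replicate (2 ^ k) True # take i xs)) = 2 ^ k) \<and>
      (\<exists>i<t. tt (size_bound \<epsilon> k) k (xs ! i) \<noteq> S (replicate (2 ^ k) True # take i xs))"
    unfolding Let_def by blast
  obtain N p where N: "wf_tm N"
    "\<And>xs. halts_with N (tuple_word xs) (bits_word (S xs)) (poly p (length (tuple_word xs)))"
    using S unfolding polytime_computable_def by blast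
  obtain d where d: "1 \<le> d" and small: "\<And>L. L \<in> class_P \<Longrightarrow>
      \<exists>C. decided_by L C \<and> (\<lambda>n. real (length (C n))) \<in> O(\<lambda>n. real n ^ d)"
    using assms(1) unfolding hypothesis_H_def by blast
  \<comment> \<open>The order of choices avoids a circle: \<open>d\<close> is common to all
    languages in P, so \<open>e\<close> is independent of \<open>c\<close>. The family
    \<open>C\<close> and its constants \<open>A\<close> and \<open>n0\<close> depend on
    \<open>c\<close>, but are fixed before \<open>k\<close>.\<close>
  define e where "e = exponent d t"
  \<comment> \<open>With \<open>h = k div q\<close>, this gives
    \<open>(2 ^ h) ^ e \<le> 2 powr (\<epsilon> * k) \<le> s\<close>.\<close>
  define q where "q = nat \<lceil>real e / \<epsilon>\<rceil>"
  \<comment> \<open>The factor 2 absorbs the rounding in \<open>h = k div q\<close>: for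
    \<open>h \<ge> 1\<close>, \<open>k < q * (h + 1) \<le> h * (2 * q + 1)\<close>.\<close>
  define c where "c = 2 * q"
  have e: "2 \<le> e"
    using exponent_mono[OF d, of 0 t] by (simp add: e_def)
  have "real e / \<epsilon> \<le> real q"
    unfolding q_def by linarith
  then have eq: "real e \<le> \<epsilon> * real q"
    using assms(2) by (simp add: field_simps)
  then have q: "0 < q"
    using e by (cases q) auto
  obtain C where C: "decided_by {x. \<exists>ys. tuple_word ys = expander.expanded_input c x \<and>
      expander.expanded_index c x < length (S ys) \<and> S ys ! expander.expanded_index c x} C"
    "(\<lambda>n. real (length (C n))) \<in> O(\<lambda>n. real n ^ d)"
    using small[OF expander_class_P[OF N]] by blast
  obtain a where "eventually (\<lambda>n. norm (real (length (C n))) \<le> a * norm (real n ^ d)) sequentially"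
    using landau_o.bigE[OF C(2)] by blast
  then obtain n0 where n0: "\<And>n. n0 \<le> n \<Longrightarrow> real (length (C n)) \<le> a * real n ^ d"
    unfolding eventually_sequentially by auto
  define A where "A = nat \<lceil>a\<rceil>"
  have A: "length (C n) \<le> A * n ^ d" if "n0 \<le> n" for n
  proof -
    have "a \<le> real A"
      unfolding A_def by linarith
    then have "a * real n ^ d \<le> real A * real n ^ d"
      by (intro mult_right_mono) auto
    then have "real (length (C n)) \<le> real (A * n ^ d)"
      using n0[OF that] by simp
    then show ?thesis
      by (simp only: of_nat_le_iff)
  qed
  define b where "b = Max {7, t, 4 * c + 5, A, n0}"
  have "eventually (\<lambda>k. q \<le> k \<and> code_len (size_bound \<epsilon> k) < 2 ^ k \<and> b \<le> 2 ^ (k div q) \<and> k \<le> 2 ^ (k div q)) sequentially"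
    using eventually_code_len_less[OF assms(2,3)] eventually_power_div[OF q, of b] eventually_ge_at_top[of q]
    by eventually_elim simp
  then obtain k where k: "q \<le> k" "code_len (size_bound \<epsilon> k) < 2 ^ k" "b \<le> 2 ^ (k div q)" "k \<le> 2 ^ (k div q)"
    by (metis (mono_tags, lifting) eventually_sequentially order_refl)
  define h where "h = k div q"
  define s where "s = size_bound \<epsilon> k"
  have "1 \<le> h"
    using k(1) q by (simp add: h_def Suc_le_eq div_greater_zero_iff)
  have "k < q * h + q"
    using dividend_less_times_div[OF q, of k] by (simp add: h_def add.commute)
  also have "\<dots> \<le> h * Suc c"
    using mult_le_mono1[OF \<open>1 \<le> h\<close>, of q] by (simp add: c_def algebra_simps trans_le_add2)
  finally have kh: "k < h * Suc c" .
  have B: "7 \<le> (2::nat) ^ h" "t \<le> 2 ^ h" "4 * c + 5 \<le> 2 ^ h" "A \<le> 2 ^ h" "n0 \<le> 2 ^ h" "k \<le> 2 ^ h"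
    using k(3,4) by (auto simp: b_def h_def)
  have "real h * real e \<le> \<epsilon> * (real h * real q)"
    using mult_left_mono[OF eq, of "real h"] by (simp add: algebra_simps)
  also have "\<dots> \<le> \<epsilon> * real k"
    using assms(2) by (intro mult_left_mono) (simp_all add: h_def flip: of_nat_mult)
  finally have "2 powr (real h * real e) \<le> 2 powr (\<epsilon> * real k)"
    by simp
  also have "\<dots> \<le> real s"
    unfolding s_def size_bound_def by linarith
  finally have "real ((2 ^ h) ^ e) \<le> real s"
    by (simp add: powr_realpow flip: power_mult of_nat_mult)
  then have s: "(2 ^ h) ^ e \<le> s"
    by (simp only: of_nat_le_iff)
  have len: "length (S (replicate (2 ^ k) True # xs)) = 2 ^ k"
    if "length xs < t" "\<forall>x \<in> set xs. length x = code_len s" for xs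
  proof -
    \<comment> \<open>The assumption speaks of full \<open>t\<close>-tuples, so a shorter history is
      filled up with zero strings, which \<open>take\<close> removes again.\<close>
    define ys where "ys = xs @ replicate (t - length xs) (replicate (code_len s) False)"
    have "length ys = t" "\<forall>x \<in> set ys. length x = code_len s" "take (length xs) ys = xs"
      using that by (auto simp: ys_def)
    then show ?thesis
      using witness[of k ys] k(1,2) q that(1) by (metis One_nat_def Suc_leI less_le_trans s_def)
  qed
  obtain xs where "length xs = t" "\<forall>x \<in> set xs. length x = code_len s"
    "\<forall>i<t. tt s k (xs ! i) = S (replicate (2 ^ k) True # take i xs)"
    using teacher_strategy[OF N(1) d C(1) A kh B s[unfolded e_def] _ _ len]
      size_bound_le[OF assms(3), of k] k(2) unfolding s_def by blast
  \<comment> \<open>For these answers all \<open>t\<close> disjuncts fail at once.\<close>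
  then show False
    using witness[of k xs] k(1,2) q unfolding s_def by auto
qed

end
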